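(* Fix the equation of state and $K>1$. There is $\delta>0$, depending only on the equation of state and $K$ (in particular independent of $U$), such that for every steady self-similar entropy solution $U$ of the two-dimensional full Euler equations with values in $\mathcal P_K$ and without stagnation points ($|\vec u(\theta)|\ne0$ for every $\theta$): the set of $\theta\in[0,2\pi[$ with $N(\theta)=0$ is finite; moreover, if $N(\theta_0)=0$ and $U$ has a shock at $\theta'$, then $|\theta'-\theta_0|\ge\delta$.
   Context: Notation: $\rho$ density, $\tau=1/\rho$, $\vec u=(u,v)$ velocity, $p$ pressure, $e$ specific internal energy, $S$ specific entropy, $T>0$ temperature, $E=\rho\left(\frac{u^2+v^2}{2}+e\right)$, $U=(\rho,\rho u,\rho v,E)^T$. Any two of $p,T,\tau,e,S$ determine the others. Phase space: $\mathcal P_K$ is the set of $U$ with $K^{-1}\le\rho\le K$, $K^{-1}\le e\le K$, $|U|\le K$. Equation of state: $p=g(\tau,S)$, smooth on the phase space, with $g_\tau=-\rho^2c^2<0$ (this defines the sound speed $c>0$), $g_{\tau\tau}>0$, $g_S>0$, and $(\partial e/\partial\tau)_S=-p$, $(\partial e/\partial S)_\tau=T$. It is also assumed that for each fixed state $(\tau_+,p_+)$ the set of $(\tau,p)$ with $e(\tau,p)-e(\tau_+,p_+)+\frac12(\tau-\tau_+)(p+p_+)=0$ is a smooth curve of the form $p=G(\tau)$. Fluxes: $f^x(U)=(\rho u,\rho u^2+p,\rho uv,u(E+p))^T$, $f^y(U)=(\rho v,\rho uv,\rho v^2+p,v(E+p))^T$, $\psi^x=\rho uS$, $\psi^y=\rho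 vS$. A steady self-similar entropy solution is a $2\pi$-periodic function $\theta\mapsto U(\theta)\in\mathcal P_K$ in $L^\infty$ ($\theta$ is the polar angle), in a version such that for all $\theta_1<\theta_2$ $$(\sin\theta f^x(U)-\cos\theta f^y(U))\big|_{\theta_1}^{\theta_2}=\int_{\theta_1}^{\theta_2}\cos\eta f^x(U(\eta))+\sin\eta f^y(U(\eta))\,d\eta,$$ $$(\sin\theta\psi^x(U)-\cos\theta\psi^y(U))\big|_{\theta_1}^{\theta_2}\le\int_{\theta_1}^{\theta_2}\cos\eta\psi^x(U(\eta))+\sin\eta\psi^y(U(\eta))\,d\eta.$$ In the absence of stagnation points $U$ has one-sided limits at every discontinuity, and $U$ is normalised to be right-continuous. Normal velocity: $N(\theta)=u(\theta)\sin\theta-v(\theta)\cos\theta$. If $U$ is discontinuous at $\theta_0$, it has a forward (resp. backward) facing shock there if $N>0$ (resp. $N<0$) on a neighborhood of $\theta_0$. A shock is a forward or backward facing shock. *)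

theory Defs
  imports "HOL-Analysis.Analysis"
begin

primrec Ck_on :: "nat \<Rightarrow> 'a::real_normed_vector set \<Rightarrow> ('a \<Rightarrow> 'b::real_normed_vector) \<Rightarrow> bool" where
  "Ck_on 0 X f \<longleftrightarrow> continuous_on X f"
| "Ck_on (Suc k) X f \<longleftrightarrow>
     (\<forall>x\<in>X. f differentiable (at x)) \<and> (\<forall>v. Ck_on k X (\<lambda>x. frechet_derivative f (at x) v))"

(* C-infinity; meant for open X only, as derivatives are taken in the full neighbourhood filter *)
definition smooth_on :: "'a::real_normed_vector set \<Rightarrow> ('a \<Rightarrow> 'b::real_normed_vector) \<Rightarrow> bool" where
  "smooth_on X f \<longleftrightarrow> (\<forall>k. Ck_on k X f)"

(* The independent thermodynamic variables are (tau, S), specific volume and specific entropy.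
   The set states is the domain of the constitutive functions; their values outside it are
   irrelevant. *)
record eos =
  states :: "(real \<times> real) set"
  pres :: "real \<Rightarrow> real \<Rightarrow> real"
  ener :: "real \<Rightarrow> real \<Rightarrow> real"
  temp :: "real \<Rightarrow> real \<Rightarrow> real"

(* Set of (tau, p) on the Hugoniot locus of the state with specific volume tp, entropy sp.
   Since (tau, p) determines S (see equation_of_state), ener tau S is e(tau, p). *)
definition hugoniot :: "eos \<Rightarrow> real \<Rightarrow> real \<Rightarrow> (real \<times> real) set" where
  "hugoniot Q tp sp =
     {(\<tau>, pres Q \<tau> s) | \<tau> s. (\<tau>, s) \<in> states Q \<and>
        ener Q \<tau> s - ener Q tp sp + (\<tau> - tp) * (pres Q \<tau> s + pres Q tp sp) / 2 = 0}"

(* The condition g_tau < 0 defines the sound speed c > 0 by c^2 = - tau^2 g_tau.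
   "Any two variables determine the others" is required for the pairs (tau, S), (tau, e),
   (tau, p) only: for a polytropic gas the pair (e, T) does not determine the state. *)
definition equation_of_state :: "eos \<Rightarrow> bool" where
  "equation_of_state Q \<longleftrightarrow>
     open (states Q) \<and>
     smooth_on (states Q) (\<lambda>(\<tau>, s). pres Q \<tau> s) \<and>
     smooth_on (states Q) (\<lambda>(\<tau>, s). ener Q \<tau> s) \<and>
     (\<forall>(\<tau>, s) \<in> states Q.
        \<tau> > 0 \<and>
        temp Q \<tau> s > 0 \<and>
        ((\<lambda>t. ener Q t s) has_real_derivative - pres Q \<tau> s) (at \<tau>) \<and>
        ((\<lambda>r. ener Q \<tau> r) has_real_derivative temp Q \<tau> s) (at s) \<and>
        deriv (\<lambda>t. pres Q t s) \<tau> < 0 \<and>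
        deriv (deriv (\<lambda>t. pres Q t s)) \<tau> > 0 \<and>
        deriv (\<lambda>r. pres Q \<tau> r) s > 0) \<and>
     (\<forall>\<tau> s s'. (\<tau>, s) \<in> states Q \<and> (\<tau>, s') \<in> states Q \<and> ener Q \<tau> s = ener Q \<tau> s' \<longrightarrow> s = s') \<and>
     (\<forall>\<tau> s s'. (\<tau>, s) \<in> states Q \<and> (\<tau>, s') \<in> states Q \<and> pres Q \<tau> s = pres Q \<tau> s' \<longrightarrow> s = s') \<and>
     (\<forall>(tp, sp) \<in> states Q. \<exists>I G. open I \<and> is_interval I \<and> smooth_on I G \<and>
        hugoniot Q tp sp = (\<lambda>\<tau>. (\<tau>, G \<tau>)) ` (I :: real set))"

(* A state vector is U = (rho, rho u, rho v, E) with E = rho ((u^2 + v^2) / 2 + e). *)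
definition rho :: "real^4 \<Rightarrow> real" where "rho U = U $ 1"
definition tau :: "real^4 \<Rightarrow> real" where "tau U = 1 / rho U"
definition xvel :: "real^4 \<Rightarrow> real" where "xvel U = U $ 2 / rho U"
definition yvel :: "real^4 \<Rightarrow> real" where "yvel U = U $ 3 / rho U"
definition total_energy :: "real^4 \<Rightarrow> real" where "total_energy U = U $ 4"
definition internal_energy :: "real^4 \<Rightarrow> real" where
  "internal_energy U = total_energy U / rho U - ((xvel U)\<^sup>2 + (yvel U)\<^sup>2) / 2"

definition entropy :: "eos \<Rightarrow> real^4 \<Rightarrow> real" where
  "entropy Q U = (THE s. (tau U, s) \<in> states Q \<and> ener Q (tau U) s = internal_energy U)"
definition pressure :: "eos \<Rightarrow> real^4 \<Rightarrow> real" where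
  "pressure Q U = pres Q (tau U) (entropy Q U)"

definition phase_space :: "real \<Rightarrow> (real^4) set" where
  "phase_space K = {U. 1 / K \<le> rho U \<and> rho U \<le> K \<and>
     1 / K \<le> internal_energy U \<and> internal_energy U \<le> K \<and> norm U \<le> K}"

(* The equation of state is available at every thermodynamic state (tau, e) occurring in X. *)
definition eos_defined_on :: "eos \<Rightarrow> (real^4) set \<Rightarrow> bool" where
  "eos_defined_on Q X \<longleftrightarrow>
     (\<forall>U\<in>X. \<exists>s. (tau U, s) \<in> states Q \<and> ener Q (tau U) s = internal_energy U)"

definition xflux :: "eos \<Rightarrow> real^4 \<Rightarrow> real^4" where
  "xflux Q U = vector
     [rho U * xvel U,
      rho U * (xvel U)\<^sup>2 + pressure Q U,
      rho U * xvel U * yvel U,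
      xvel U * (total_energy U + pressure Q U)]"
definition yflux :: "eos \<Rightarrow> real^4 \<Rightarrow> real^4" where
  "yflux Q U = vector
     [rho U * yvel U,
      rho U * xvel U * yvel U,
      rho U * (yvel U)\<^sup>2 + pressure Q U,
      yvel U * (total_energy U + pressure Q U)]"
definition xentropy_flux :: "eos \<Rightarrow> real^4 \<Rightarrow> real" where
  "xentropy_flux Q U = rho U * xvel U * entropy Q U"
definition yentropy_flux :: "eos \<Rightarrow> real^4 \<Rightarrow> real" where
  "yentropy_flux Q U = rho U * yvel U * entropy Q U"

definition steady_selfsimilar_entropy_solution :: "eos \<Rightarrow> real \<Rightarrow> (real \<Rightarrow> real^4) \<Rightarrow> bool" where
  "steady_selfsimilar_entropy_solution Q K U \<longleftrightarrow>
     U \<in> borel_measurable lebesgue \<and>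
     (\<forall>\<theta>. U \<theta> \<in> phase_space K) \<and>
     (\<forall>\<theta>. U (\<theta> + 2 * pi) = U \<theta>) \<and>
     (\<forall>\<theta>1 \<theta>2. \<theta>1 < \<theta>2 \<longrightarrow>
        (sin \<theta>2 *\<^sub>R xflux Q (U \<theta>2) - cos \<theta>2 *\<^sub>R yflux Q (U \<theta>2))
          - (sin \<theta>1 *\<^sub>R xflux Q (U \<theta>1) - cos \<theta>1 *\<^sub>R yflux Q (U \<theta>1))
        = integral {\<theta>1..\<theta>2}
            (\<lambda>\<eta>. cos \<eta> *\<^sub>R xflux Q (U \<eta>) + sin \<eta> *\<^sub>R yflux Q (U \<eta>))) \<and>
     (\<forall>\<theta>1 \<theta>2. \<theta>1 < \<theta>2 \<longrightarrow>
        (sin \<theta>2 * xentropy_flux Q (U \<theta>2) - cos \<theta>2 * yentropy_flux Q (U \<theta>2))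
          - (sin \<theta>1 * xentropy_flux Q (U \<theta>1) - cos \<theta>1 * yentropy_flux Q (U \<theta>1))
        \<le> integral {\<theta>1..\<theta>2}
            (\<lambda>\<eta>. cos \<eta> * xentropy_flux Q (U \<eta>) + sin \<eta> * yentropy_flux Q (U \<eta>)))"

definition right_continuous_version :: "(real \<Rightarrow> real^4) \<Rightarrow> bool" where
  "right_continuous_version U \<longleftrightarrow>
     (\<forall>\<theta>. (U \<longlongrightarrow> U \<theta>) (at_right \<theta>)) \<and>
     (\<forall>\<theta>. \<not> isCont U \<theta> \<longrightarrow> (\<exists>l. (U \<longlongrightarrow> l) (at_left \<theta>)))"

definition no_stagnation_points :: "(real \<Rightarrow> real^4) \<Rightarrow> bool" where
  "no_stagnation_points U \<longleftrightarrow> (\<forall>\<theta>. norm (xvel (U \<theta>), yvel (U \<theta>)) \<noteq> 0)"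

definition normal_velocity :: "(real \<Rightarrow> real^4) \<Rightarrow> real \<Rightarrow> real" where
  "normal_velocity U \<theta> = xvel (U \<theta>) * sin \<theta> - yvel (U \<theta>) * cos \<theta>"

definition forward_shock :: "(real \<Rightarrow> real^4) \<Rightarrow> real \<Rightarrow> bool" where
  "forward_shock U \<theta> \<longleftrightarrow> \<not> isCont U \<theta> \<and> (\<forall>\<^sub>F \<eta> in nhds \<theta>. normal_velocity U \<eta> > 0)"
definition backward_shock :: "(real \<Rightarrow> real^4) \<Rightarrow> real \<Rightarrow> bool" where
  "backward_shock U \<theta> \<longleftrightarrow> \<not> isCont U \<theta> \<and> (\<forall>\<^sub>F \<eta> in nhds \<theta>. normal_velocity U \<eta> < 0)"
definition shock :: "(real \<Rightarrow> real^4) \<Rightarrow> real \<Rightarrow> bool" where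
  "shock U \<theta> \<longleftrightarrow> forward_shock U \<theta> \<or> backward_shock U \<theta>"

end

theory Submission
  imports Defs
begin

text \<open>
  Write \<open>N\<close> and \<open>L\<close> for the velocity components across and along the ray at angle \<open>\<theta>\<close>, and
  \<open>M = \<rho> N\<close> for the mass flux across it. In these variables mass and momentum balance read
  \<open>M' = \<rho> L\<close>, \<open>(\<rho> N\<^sup>2 + p)' = 2 \<rho> N L\<close> and \<open>(M L)' = \<rho> (L\<^sup>2 - N\<^sup>2)\<close>, so that \<open>L' = - N\<close> wherever
  \<open>M \<noteq> 0\<close>. All fluxes across the ray are Lipschitz continuous in \<open>\<theta>\<close>, with a constant that depends
  on the equation of state and \<open>K\<close> only, because they are integrals of bounded functions.

  \<^emph>\<open>Distance of shocks.\<close> Since \<open>M\<close> is uniformly Lipschitz, it suffices to bound \<open>|M|\<close> from below at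
  every shock (\<open>mass_flux_across_discontinuity\<close>). The jump conditions give \<open>[L] = 0\<close>,
  \<open>[p] = - M\<^sup>2 [\<tau>]\<close> and the Hugoniot relation \<open>[e] = - pm [\<tau>]\<close> with \<open>pm\<close> the mean of the two pressures.
  Hence the chord joining the two thermal states in the \<open>(\<tau>, e)\<close> plane has slope \<open>- pm\<close>, and the
  thermal states of the phase space form a convex set in that plane, so the equation of state is
  available along the chord. There \<open>dS = (de + p d\<tau>) / T\<close> shows that the pressure \<open>\<pi>(\<tau>)\<close> obeys
  \<open>\<pi>' = g_\<tau> + (g_S / T) (\<pi> - pm)\<close>. As \<open>g_\<tau>\<close> is bounded away from zero, \<open>\<pi>\<close> drops at a definite rate
  as long as it is close to \<open>pm\<close>. Its end values lie symmetrically about \<open>pm\<close>, so either they are far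
  apart, or \<open>\<pi>\<close> stays close to \<open>pm\<close> and drops steadily all along the chord. In both cases
  \<open>M\<^sup>2 = - [p] / [\<tau>]\<close> is bounded from below (\<open>hugoniot_chord_slope_bound\<close>).

  \<^emph>\<open>Finitely many zeros.\<close> At a zero of \<open>N\<close> the velocity is radial and nonzero, so \<open>M\<close> has a nonzero
  right derivative \<open>\<rho> L\<close> there and the zero is isolated from the right; a next zero exists
  by compactness. If two consecutive zeros \<open>a < b\<close> are closer than the distance of shocks, then
  \<open>U\<close> is continuous between them and \<open>M' = \<rho> L\<close>, \<open>L' = - N\<close> hold classically. For
  constant \<open>\<rho>\<close> the velocity would be a constant vector and the zeros \<open>\<pi>\<close> apart; in general
  a comparison argument still gives \<open>b - a \<ge> 1 / K\<close> (\<open>zero_gap\<close>). So the zeros are uniformly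
  separated (\<open>zeros_separated\<close>), and a bounded interval contains finitely many of them.
\<close>

section \<open>Functions that fall while they are small\<close>

text \<open>At its first contact with the level \<open>k\<close> the function would have to be
  decreasing, hence larger than \<open>k\<close> shortly before.\<close>

lemma stays_below_barrier:
  fixes q :: "real \<Rightarrow> real"
  assumes "x \<le> y" and cont: "continuous_on {x..y} q" and "q x < k"
    and down: "\<And>t. \<lbrakk>x < t; t \<le> y; q t = k\<rbrakk> \<Longrightarrow> \<exists>D<0. (q has_real_derivative D) (at t within {x..y})"
    and t: "t \<in> {x..y}"
  shows "q t < k"
proof (rule ccontr)
  assume "\<not> q t < k"
  define A where "A = {x..y} \<inter> q -` {k..}"
  have "t \<in> A" using t \<open>\<not> q t < k\<close> by (auto simp: A_def)
  have "closed A"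
    unfolding A_def by (rule continuous_closed_preimage[OF cont]) auto
  moreover have "bounded A"
    unfolding A_def by (rule bounded_subset[OF bounded_closed_interval]) auto
  ultimately have "compact A" by (simp add: compact_eq_bounded_closed)
  then obtain m where m: "m \<in> A" "\<And>u. u \<in> A \<Longrightarrow> m \<le> u"
    using compact_attains_inf \<open>t \<in> A\<close> by (metis empty_iff)
  have before: "q u < k" if "x \<le> u" "u < m" for u
    using m that by (force simp: A_def)
  have m_in: "x \<le> m" "m \<le> y" "k \<le> q m" using m(1) by (auto simp: A_def)
  then have "x < m" using \<open>q x < k\<close> by (metis less_le_not_le order_le_less)
  \<comment> \<open>The first time at or above the barrier lies on it.\<close>
  have "q m = k"
  proof (rule ccontr)
    assume "q m \<noteq> k"
    then have "k < q m" using m_in by simp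
    have "continuous_on {x..m} q" using cont \<open>m \<le> y\<close> by (auto intro: continuous_on_subset)
    then obtain u where "x \<le> u" "u \<le> m" "q u = k"
      using IVT'[of q x k m] \<open>q x < k\<close> \<open>k < q m\<close> \<open>x < m\<close> by (meson less_imp_le)
    then show False using before[of u] \<open>k < q m\<close> by (cases "u = m") auto
  qed
  then obtain D where D: "D < 0" "(q has_real_derivative D) (at m within {x..y})"
    using down \<open>x < m\<close> \<open>m \<le> y\<close> by blast
  from has_real_derivative_neg_dec_left[OF D(2) D(1)]
  obtain d where d: "d > 0" "\<And>h. \<lbrakk>0 < h; m - h \<in> {x..y}; h < d\<rbrakk> \<Longrightarrow> q m < q (m - h)"
    by auto
  define h where "h = min (d / 2) (m - x)"
  have "0 < h" "h < d" "m - h \<in> {x..y}"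
    using d(1) \<open>x < m\<close> \<open>m \<le> y\<close> by (auto simp: h_def min_def)
  with d(2)[of h] before[of "m - h"] \<open>q m = k\<close> show False by auto
qed

text \<open>If the drop \<open>2 q(x)\<close> is below \<open>a / b\<close>, then \<open>|q|\<close>
  starts and ends below \<open>k = a / (2 b)\<close>. The levels \<open>k\<close> and \<open>- k\<close>
  can only be crossed downwards, so \<open>|q| < k\<close> throughout, and there
  \<open>q' \<le> - a / 2\<close>.\<close>

lemma antisymmetric_drop_lower_bound:
  fixes q :: "real \<Rightarrow> real"
  assumes "x < y" "a > 0" "b > 0"
    and der: "\<And>t. t \<in> {x..y} \<Longrightarrow> (q has_real_derivative q' t) (at t within {x..y})"
    and bound: "\<And>t. t \<in> {x..y} \<Longrightarrow> q' t \<le> - a + b * \<bar>q t\<bar>"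
    and ends: "q y = - q x" and "q x \<ge> 0"
  shows "2 * q x \<ge> min (a / b) (a / 2 * (y - x))"
proof (cases "2 * q x \<ge> a / b")
  case False
  define k where "k = a / (2 * b)"
  have "k > 0" and bk: "b * k = a / 2" using assms(2,3) by (auto simp: k_def)
  have "q x < k" using False by (simp add: k_def)
  have cont: "continuous_on {x..y} q"
    using der by (meson DERIV_continuous_on)
  have steep: "q' t \<le> - a / 2" if "t \<in> {x..y}" "\<bar>q t\<bar> \<le> k" for t
    using bound[OF that(1)] mult_left_mono[OF that(2), of b] \<open>b > 0\<close> bk by linarith
  have upper: "q t < k" if "t \<in> {x..y}" for t
  proof (rule stays_below_barrier[OF _ cont \<open>q x < k\<close> _ that])
    fix t assume "x < t" "t \<le> y" "q t = k"
    then show "\<exists>D<0. (q has_real_derivative D) (at t within {x..y})"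
      using der[of t] steep[of t] \<open>k > 0\<close> \<open>a > 0\<close> by (intro exI[of _ "q' t"]) auto
  qed (use \<open>x < y\<close> in auto)
  \<comment> \<open>The reflection \<open>t \<mapsto> - t\<close> turns the bound from below into the bound from above.\<close>
  have lower: "- k < q t" if "t \<in> {x..y}" for t
  proof -
    have "- q (- (- t)) < k"
    proof (rule stays_below_barrier[of "- y" "- x" "\<lambda>s. - q (- s)" k "- t"])
      show "continuous_on {- y..- x} (\<lambda>s. - q (- s))"
        by (intro continuous_intros continuous_on_compose2[OF cont]) auto
      show "- q (- (- y)) < k" using ends \<open>q x < k\<close> by simp
      fix s assume s: "- y < s" "s \<le> - x" "- q (- s) = k"
      have "uminus ` {- y..- x} = {x..y}" by simp
      then have "(q has_real_derivative q' (- s)) (at (- s) within uminus ` {- y..- x})"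
        using der[of "- s"] s by simp
      from DERIV_minus[OF DERIV_image_chain[OF this DERIV_minus[OF DERIV_ident]]]
      have "((\<lambda>s. - q (- s)) has_real_derivative q' (- s)) (at s within {- y..- x})"
        by (simp add: o_def)
      then show "\<exists>D<0. ((\<lambda>s. - q (- s)) has_real_derivative D) (at s within {- y..- x})"
        using steep[of "- s"] s \<open>k > 0\<close> \<open>a > 0\<close> by (intro exI[of _ "q' (- s)"]) auto
    qed (use \<open>x < y\<close> that in auto)
    then show ?thesis by simp
  qed
  obtain \<xi> where \<xi>: "x < \<xi>" "\<xi> < y" "q y - q x = (y - x) * q' \<xi>"
  proof -
    have "(q has_derivative (*) (q' t)) (at t)" if "x < t" "t < y" for t
      using der[of t] that at_within_Icc_at[of x t y] by (simp add: has_field_derivative_def)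
    with mvt[OF \<open>x < y\<close> cont, of "\<lambda>t. (*) (q' t)"] that show ?thesis
      by (metis mult.commute)
  qed
  have "q' \<xi> \<le> - a / 2" using steep upper[of \<xi>] lower[of \<xi>] \<xi> by (auto simp: abs_le_iff)
  then have "(y - x) * q' \<xi> \<le> (y - x) * (- a / 2)" using \<open>x < y\<close> by (intro mult_left_mono) auto
  then have "a / 2 * (y - x) \<le> 2 * q x" using \<xi> ends by (simp add: algebra_simps)
  then show ?thesis by simp
qed auto

section \<open>Constitutive functions\<close>

text \<open>Links the Frechet derivatives, in terms of which smoothness is phrased, with the partial
  derivatives that occur in the equation of state.\<close>

lemma Ck_on_partials:
  fixes f :: "real \<Rightarrow> real \<Rightarrow> real"
  assumes "Ck_on 1 X (\<lambda>(t, s). f t s)" "(t, s) \<in> X"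
  shows "((\<lambda>(t, s). f t s) has_derivative
      (\<lambda>h. deriv (\<lambda>t. f t s) t * fst h + deriv (\<lambda>s. f t s) s * snd h)) (at (t, s))"
    and "deriv (\<lambda>t. f t s) t = frechet_derivative (\<lambda>(t, s). f t s) (at (t, s)) (1, 0)"
    and "deriv (\<lambda>s. f t s) s = frechet_derivative (\<lambda>(t, s). f t s) (at (t, s)) (0, 1)"
proof -
  define D where "D = frechet_derivative (\<lambda>(t, s). f t s) (at (t, s))"
  have D: "((\<lambda>(t, s). f t s) has_derivative D) (at (t, s))"
    using assms(1,2) by (auto simp: D_def frechet_derivative_works)
  then have lin: "linear D" by (rule has_derivative_linear)
  have Dlin: "D h = D (1, 0) * fst h + D (0, 1) * snd h" for h
  proof -
    have "D h = D (fst h *\<^sub>R (1, 0) + snd h *\<^sub>R (0, 1))" by (cases h) simp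
    also have "\<dots> = fst h *\<^sub>R D (1, 0) + snd h *\<^sub>R D (0, 1)"
      by (simp only: linear_add[OF lin] linear_scale[OF lin])
    finally show ?thesis by (simp add: mult.commute)
  qed
  have "((\<lambda>r. (\<lambda>(t, s). f t s) (r, s)) has_derivative (\<lambda>r. D (r, 0))) (at t)"
    using has_derivative_compose[OF has_derivative_Pair[OF has_derivative_ident has_derivative_const] D]
    by simp
  moreover have "(\<lambda>r. D (r, 0)) = (*) (D (1, 0))" by (rule ext) (subst Dlin, simp)
  ultimately have t: "((\<lambda>t. f t s) has_real_derivative D (1, 0)) (at t)"
    by (simp add: has_field_derivative_def)
  have "((\<lambda>r. (\<lambda>(t, s). f t s) (t, r)) has_derivative (\<lambda>r. D (0, r))) (at s)"
    using has_derivative_compose[OF has_derivative_Pair[OF has_derivative_const has_derivative_ident] D]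
    by simp
  moreover have "(\<lambda>r. D (0, r)) = (*) (D (0, 1))" by (rule ext) (subst Dlin, simp)
  ultimately have s: "((\<lambda>s. f t s) has_real_derivative D (0, 1)) (at s)"
    by (simp add: has_field_derivative_def)
  show a: "deriv (\<lambda>t. f t s) t = frechet_derivative (\<lambda>(t, s). f t s) (at (t, s)) (1, 0)"
    unfolding D_def[symmetric] by (rule DERIV_imp_deriv[OF t])
  show b: "deriv (\<lambda>s. f t s) s = frechet_derivative (\<lambda>(t, s). f t s) (at (t, s)) (0, 1)"
    unfolding D_def[symmetric] by (rule DERIV_imp_deriv[OF s])
  have "D = (\<lambda>h. deriv (\<lambda>t. f t s) t * fst h + deriv (\<lambda>s. f t s) s * snd h)"
    using Dlin unfolding a b D_def[symmetric] by (rule ext)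
  with D show "((\<lambda>(t, s). f t s) has_derivative
      (\<lambda>h. deriv (\<lambda>t. f t s) t * fst h + deriv (\<lambda>s. f t s) s * snd h)) (at (t, s))"
    by simp
qed

locale gas =
  fixes Q :: eos and K :: real
  assumes eos: "equation_of_state Q"
    and K: "K > 1"
    and defined: "eos_defined_on Q (phase_space K)"
begin

abbreviation "pres_tau \<tau> s \<equiv> deriv (\<lambda>t. pres Q t s) \<tau>"
abbreviation "pres_ent \<tau> s \<equiv> deriv (\<lambda>r. pres Q \<tau> r) s"

lemma open_states: "open (states Q)"
  using eos by (simp add: equation_of_state_def)

lemma smooth_pres: "Ck_on k (states Q) (\<lambda>(t, s). pres Q t s)"
  and smooth_ener: "Ck_on k (states Q) (\<lambda>(t, s). ener Q t s)"
  using eos by (auto simp: equation_of_state_def smooth_on_def)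

lemma state_signs:
  assumes "(\<tau>, s) \<in> states Q"
  shows "temp Q \<tau> s > 0" "pres_tau \<tau> s < 0" "pres_ent \<tau> s > 0"
  using eos assms unfolding equation_of_state_def by (auto dest!: bspec)

lemma pres_has_derivative:
  assumes "(\<tau>, s) \<in> states Q"
  shows "((\<lambda>(t, s). pres Q t s) has_derivative
    (\<lambda>h. pres_tau \<tau> s * fst h + pres_ent \<tau> s * snd h)) (at (\<tau>, s))"
  by (rule Ck_on_partials(1)[OF smooth_pres assms])

lemma ener_partials:
  assumes "(\<tau>, s) \<in> states Q"
  shows "((\<lambda>t. ener Q t s) has_real_derivative - pres Q \<tau> s) (at \<tau>)"
    "((\<lambda>r. ener Q \<tau> r) has_real_derivative temp Q \<tau> s) (at s)"
  using eos assms unfolding equation_of_state_def by (auto dest!: bspec)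

lemma ener_has_derivative:
  assumes "(\<tau>, s) \<in> states Q"
  shows "((\<lambda>(t, s). ener Q t s) has_derivative
    (\<lambda>h. - pres Q \<tau> s * fst h + temp Q \<tau> s * snd h)) (at (\<tau>, s))"
  using Ck_on_partials(1)[OF smooth_ener assms] ener_partials[OF assms, THEN DERIV_imp_deriv]
  by simp

lemma continuous_constitutive:
  "continuous_on (states Q) (\<lambda>(\<tau>, s). pres_tau \<tau> s)"
  "continuous_on (states Q) (\<lambda>(\<tau>, s). pres_ent \<tau> s)"
  "continuous_on (states Q) (\<lambda>(\<tau>, s). temp Q \<tau> s)"
  "continuous_on (states Q) (\<lambda>(\<tau>, s). pres Q \<tau> s)"
proof -
  have p: "continuous_on (states Q) (\<lambda>z. frechet_derivative (\<lambda>(t, s). pres Q t s) (at z) v)"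
    and e: "continuous_on (states Q) (\<lambda>z. frechet_derivative (\<lambda>(t, s). ener Q t s) (at z) v)" for v
    using smooth_pres[of 1] smooth_ener[of 1] by (simp_all del: split_paired_All)
  show "continuous_on (states Q) (\<lambda>(\<tau>, s). pres_tau \<tau> s)"
  proof (rule continuous_on_eq[OF p[of "(1, 0)"]], clarify)
    fix \<tau> s assume st: "(\<tau>, s) \<in> states Q"
    show "frechet_derivative (\<lambda>(t, s). pres Q t s) (at (\<tau>, s)) (1, 0) = pres_tau \<tau> s"
      using Ck_on_partials(2)[OF smooth_pres st] by simp
  qed
  show "continuous_on (states Q) (\<lambda>(\<tau>, s). pres_ent \<tau> s)"
  proof (rule continuous_on_eq[OF p[of "(0, 1)"]], clarify)
    fix \<tau> s assume st: "(\<tau>, s) \<in> states Q"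
    show "frechet_derivative (\<lambda>(t, s). pres Q t s) (at (\<tau>, s)) (0, 1) = pres_ent \<tau> s"
      using Ck_on_partials(3)[OF smooth_pres st] by simp
  qed
  show "continuous_on (states Q) (\<lambda>(\<tau>, s). temp Q \<tau> s)"
  proof (rule continuous_on_eq[OF e[of "(0, 1)"]], clarify)
    fix \<tau> s assume st: "(\<tau>, s) \<in> states Q"
    show "frechet_derivative (\<lambda>(t, s). ener Q t s) (at (\<tau>, s)) (0, 1) = temp Q \<tau> s"
      using Ck_on_partials(3)[OF smooth_ener st] ener_partials(2)[OF st, THEN DERIV_imp_deriv] by simp
  qed
  show "continuous_on (states Q) (\<lambda>(\<tau>, s). pres Q \<tau> s)"
    using smooth_pres[of 0] by simp
qed

end

section \<open>Pressure as a function of volume and energy\<close>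

lemma vector_4_nth [simp]:
  "(vector [a, b, c, d] :: real^4) $ 1 = a" "(vector [a, b, c, d] :: real^4) $ 2 = b"
  "(vector [a, b, c, d] :: real^4) $ 3 = c" "(vector [a, b, c, d] :: real^4) $ 4 = d"
  unfolding vector_def by simp_all

context gas
begin

text \<open>The entropy in terms of volume and energy. The description is the one that defines the
  entropy of a state vector, so that the pressure of a state vector is a value of \<open>press\<close> by
  unfolding.\<close>

definition ent :: "real \<Rightarrow> real \<Rightarrow> real" where
  "ent \<tau> e = (THE s. (\<tau>, s) \<in> states Q \<and> ener Q \<tau> s = e)"

definition press :: "real \<Rightarrow> real \<Rightarrow> real" where
  "press \<tau> e = pres Q \<tau> (ent \<tau> e)"

definition energy_domain :: "(real \<times> real) set" where
  "energy_domain = (\<lambda>(\<tau>, s). (\<tau>, ener Q \<tau> s)) ` states Q"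

lemma ent_ener:
  assumes "(\<tau>, s) \<in> states Q"
  shows "ent \<tau> (ener Q \<tau> s) = s"
proof -
  have "s' = s" if "(\<tau>, s') \<in> states Q" "ener Q \<tau> s' = ener Q \<tau> s" for s'
    using eos assms that unfolding equation_of_state_def by blast
  then show ?thesis unfolding ent_def using assms by (intro the_equality) auto
qed

lemma energy_domainD:
  assumes "(\<tau>, e) \<in> energy_domain"
  shows "(\<tau>, ent \<tau> e) \<in> states Q" "ener Q \<tau> (ent \<tau> e) = e"
  using assms ent_ener by (auto simp: energy_domain_def)

text \<open>The map \<open>(\<tau>, s) \<mapsto> (\<tau>, e)\<close> is injective with invertible
  derivative because \<open>T > 0\<close>. Its inverse differentiates according to
  \<open>T ds = de + p d\<tau>\<close>.\<close>

lemma ent_has_derivative: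
  assumes "(\<tau>, e) \<in> energy_domain"
  shows "((\<lambda>(t, e). (t, ent t e)) has_derivative
    (\<lambda>h. (fst h, (snd h + press \<tau> e * fst h) / temp Q \<tau> (ent \<tau> e)))) (at (\<tau>, e))"
proof -
  define f where "f = (\<lambda>(t, s). (t, ener Q t s))"
  note st = energy_domainD[OF assms]
  have T: "temp Q \<tau> (ent \<tau> e) > 0" using state_signs st by blast
  have f_split: "f = (\<lambda>z. (fst z, (\<lambda>(t, s). ener Q t s) z))" by (auto simp: f_def)
  have cf: "continuous_on (states Q) f"
    unfolding f_split using smooth_ener[of 0] by (auto intro!: continuous_intros)
  have df: "(f has_derivative
      (\<lambda>h. (fst h, - press \<tau> e * fst h + temp Q \<tau> (ent \<tau> e) * snd h))) (at (\<tau>, ent \<tau> e))"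
    unfolding f_split press_def
    by (intro has_derivative_Pair ener_has_derivative st has_derivative_fst has_derivative_ident)
  have gf: "(\<lambda>(t, e). (t, ent t e)) (f z) = z" if "z \<in> states Q" for z
    using that ent_ener by (cases z) (simp add: f_def)
  have inv: "(\<lambda>h. (fst h, - press \<tau> e * fst h + temp Q \<tau> (ent \<tau> e) * snd h)) \<circ>
      (\<lambda>h. (fst h, (snd h + press \<tau> e * fst h) / temp Q \<tau> (ent \<tau> e))) = id"
    using T by (auto simp: fun_eq_iff field_simps)
  have "((\<lambda>(t, e). (t, ent t e)) has_derivative
    (\<lambda>h. (fst h, (snd h + press \<tau> e * fst h) / temp Q \<tau> (ent \<tau> e)))) (at (f (\<tau>, ent \<tau> e)))"
    by (rule has_derivative_inverse_strong[OF open_states st(1) cf gf df inv])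
  then show ?thesis using st by (simp add: f_def)
qed

lemma continuous_on_state: "continuous_on energy_domain (\<lambda>(\<tau>, e). (\<tau>, ent \<tau> e))"
  unfolding continuous_on_eq_continuous_within
proof clarify
  fix \<tau> e assume "(\<tau>, e) \<in> energy_domain"
  from has_derivative_continuous[OF ent_has_derivative[OF this]]
  show "continuous (at (\<tau>, e) within energy_domain) (\<lambda>(\<tau>, e). (\<tau>, ent \<tau> e))"
    by (rule continuous_at_imp_continuous_at_within)
qed

lemma continuous_on_constitutive_energy:
  assumes "continuous_on (states Q) (\<lambda>(\<tau>, s). f \<tau> s)"
  shows "continuous_on energy_domain (\<lambda>(\<tau>, e). f \<tau> (ent \<tau> e))"
proof -
  have "continuous_on energy_domain (\<lambda>z. (\<lambda>(\<tau>, s). f \<tau> s) ((\<lambda>(\<tau>, e). (\<tau>, ent \<tau> e)) z))"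
    by (rule continuous_on_compose2[OF assms continuous_on_state])
      (use energy_domainD in auto)
  then show ?thesis by (simp add: case_prod_beta)
qed

lemma continuous_on_press: "continuous_on energy_domain (\<lambda>(\<tau>, e). press \<tau> e)"
  unfolding press_def by (rule continuous_on_constitutive_energy[OF continuous_constitutive(4)])

text \<open>The pairs \<open>(\<tau>, e)\<close> of the states in the phase space. In the last condition
  the bound \<open>|U| \<le> K\<close> survives: at rest it reads
  \<open>\<rho> |(1, e)| \<le> K\<close>.\<close>

definition thermal_range :: "(real \<times> real) set" where
  "thermal_range = {(\<tau>, e). 1 / K \<le> \<tau> \<and> \<tau> \<le> K \<and> 1 / K \<le> e \<and> e \<le> K \<and> norm (1::real, e) \<le> K * \<tau>}"

text \<open>In the variables \<open>(\<tau>, e)\<close> the last condition is a sublevel set of a norm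
  minus a linear function.\<close>

lemma convex_thermal_range: "convex thermal_range"
proof -
  have "convex {z :: real \<times> real. norm (1::real, snd z) \<le> K * fst z}"
  proof (rule convexI, clarsimp simp del: norm_Pair)
    fix \<tau> e \<tau>' e' u v :: real
    assume *: "norm (1::real, e) \<le> K * \<tau>" "norm (1::real, e') \<le> K * \<tau>'" "0 \<le> u" "0 \<le> v" "u + v = 1"
    have "(1::real, u * e + v * e') = u *\<^sub>R (1, e) + v *\<^sub>R (1, e')" using * by simp
    also have "norm \<dots> \<le> u * norm (1::real, e) + v * norm (1::real, e')"
      using * norm_triangle_ineq[of "u *\<^sub>R (1::real, e)" "v *\<^sub>R (1, e')"]
      by (simp only: norm_scaleR abs_of_nonneg)
    also have "\<dots> \<le> u * (K * \<tau>) + v * (K * \<tau>')"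
      using * by (intro add_mono mult_left_mono) auto
    finally show "norm (1::real, u * e + v * e') \<le> K * (u * \<tau> + v * \<tau>')"
      by (simp add: algebra_simps)
  qed
  moreover have "convex ({1 / K..K} \<times> {1 / K..K})" by (intro convex_Times convex_closed_interval)
  moreover have "thermal_range = ({1 / K..K} \<times> {1 / K..K}) \<inter> {z. norm (1::real, snd z) \<le> K * fst z}"
    by (auto simp: thermal_range_def)
  ultimately show ?thesis by (metis convex_Int)
qed

lemma compact_thermal_range: "compact thermal_range"
proof -
  have "closed {z :: real \<times> real. norm (1::real, snd z) \<le> K * fst z}"
    by (intro closed_Collect_le continuous_intros)
  moreover have "compact ({1 / K..K} \<times> {1 / K..K})" by (intro compact_Times) auto
  moreover have "thermal_range = ({1 / K..K} \<times> {1 / K..K}) \<inter> {z. norm (1::real, snd z) \<le> K * fst z}"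
    by (auto simp: thermal_range_def)
  ultimately show ?thesis by (metis compact_Int_closed)
qed

text \<open>Kinetic energy only increases the total energy, so the norm is at least that of the state at
  rest with the same density and internal energy.\<close>

lemma phase_space_thermal:
  assumes "U \<in> phase_space K"
  shows "(tau U, internal_energy U) \<in> thermal_range"
proof -
  define r e where "r = rho U" and "e = internal_energy U"
  have r: "1 / K \<le> r" "r \<le> K" "1 / K \<le> e" "e \<le> K" "norm U \<le> K"
    using assms by (auto simp: phase_space_def r_def e_def)
  moreover have "1 / K > 0" using K by simp
  ultimately have pos: "r > 0" "e > 0" by linarith+
  have "r * e \<le> U $ 4"
    using pos(1) unfolding e_def internal_energy_def total_energy_def r_def[symmetric]
    by (simp add: field_simps)
  then have "(r * e)\<^sup>2 \<le> (U $ 4)\<^sup>2" using pos by (intro power_mono) auto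
  then have "norm (r, r * e) \<le> norm U"
    unfolding norm_vec_def norm_Pair L2_set_def
    by (intro real_sqrt_le_mono) (simp add: sum_4 r_def rho_def add_increasing)
  moreover have "norm (r, r * e) = r * norm (1::real, e)"
    using norm_scaleR[of r "(1::real, e)"] pos by (simp del: norm_Pair)
  ultimately have "norm (1::real, e) \<le> K / r"
    using r pos by (simp add: pos_le_divide_eq mult.commute)
  moreover have "1 / K \<le> 1 / r" "1 / r \<le> K"
    using r pos K by (auto simp: field_simps)
  ultimately show ?thesis
    using r by (simp add: thermal_range_def tau_def r_def[symmetric] e_def[symmetric] del: norm_Pair)
qed

text \<open>The state at rest with the given volume and energy lies in the phase space.\<close>

lemma thermal_range_subset: "thermal_range \<subseteq> energy_domain"
proof clarify
  fix \<tau> e assume "(\<tau>, e) \<in> thermal_range"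
  then have *: "1 / K \<le> \<tau>" "\<tau> \<le> K" "1 / K \<le> e" "e \<le> K" "norm (1::real, e) \<le> K * \<tau>"
    by (auto simp: thermal_range_def)
  moreover have "1 / K > 0" using K by simp
  ultimately have "\<tau> > 0" by linarith
  define U :: "real^4" where "U = vector [1 / \<tau>, 0, 0, e / \<tau>]"
  have rho: "rho U = 1 / \<tau>" "tau U = \<tau>" and e: "internal_energy U = e"
    using \<open>\<tau> > 0\<close>
    by (auto simp: U_def rho_def tau_def internal_energy_def total_energy_def xvel_def yvel_def)
  have "norm U = norm ((1 / \<tau>) *\<^sub>R (1::real, e))"
    by (simp add: norm_vec_def L2_set_def sum_4 U_def norm_Pair power_divide)
  also have "\<dots> = norm (1::real, e) / \<tau>" using \<open>\<tau> > 0\<close> by (simp only: norm_scaleR) simp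
  also have "\<dots> \<le> K" using * \<open>\<tau> > 0\<close> by (simp add: pos_divide_le_eq del: norm_Pair)
  finally have "norm U \<le> K" .
  moreover have "1 / K \<le> 1 / \<tau>" "1 / \<tau> \<le> K"
    using * \<open>\<tau> > 0\<close> K by (auto simp: field_simps)
  ultimately have "U \<in> phase_space K"
    using * rho e by (simp add: phase_space_def)
  then obtain s where "(\<tau>, s) \<in> states Q" "ener Q \<tau> s = e"
    using defined rho e by (auto simp: eos_defined_on_def)
  then show "(\<tau>, e) \<in> energy_domain" by (force simp: energy_domain_def)
qed

text \<open>Compactness gives \<open>g_\<tau> \<le> - a < 0\<close> and \<open>g_S / T \<le> b\<close>.
  The deviation \<open>q\<close> of the pressure from the mean of its end values, taken along the chord
  between the two states, satisfies \<open>q' = g_\<tau> + (g_S / T) q \<le> - a + b |q|\<close> and has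
  opposite values at the ends. The volumes differ by at most \<open>K\<close>, which turns the
  alternative \<open>a / b\<close> into a bound proportional to the difference of the volumes.\<close>

lemma hugoniot_chord_slope_bound:
  "\<exists>m>0. \<forall>\<tau>\<^sub>0 e\<^sub>0 \<tau>\<^sub>1 e\<^sub>1. (\<tau>\<^sub>0, e\<^sub>0) \<in> thermal_range \<longrightarrow> (\<tau>\<^sub>1, e\<^sub>1) \<in> thermal_range \<longrightarrow> \<tau>\<^sub>0 < \<tau>\<^sub>1 \<longrightarrow>
    e\<^sub>1 = e\<^sub>0 - (press \<tau>\<^sub>0 e\<^sub>0 + press \<tau>\<^sub>1 e\<^sub>1) / 2 * (\<tau>\<^sub>1 - \<tau>\<^sub>0) \<longrightarrow>
    press \<tau>\<^sub>1 e\<^sub>1 \<le> press \<tau>\<^sub>0 e\<^sub>0 \<longrightarrow>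
    m * (\<tau>\<^sub>1 - \<tau>\<^sub>0) \<le> press \<tau>\<^sub>0 e\<^sub>0 - press \<tau>\<^sub>1 e\<^sub>1"
proof (cases "thermal_range = {}")
  case True
  then show ?thesis by (intro exI[of _ 1]) simp
next
  case False
  define gt where "gt = (\<lambda>(\<tau>, e). pres_tau \<tau> (ent \<tau> e))"
  define gs where "gs = (\<lambda>(\<tau>, e). pres_ent \<tau> (ent \<tau> e))"
  define T where "T = (\<lambda>(\<tau>, e). temp Q \<tau> (ent \<tau> e))"
  have signs: "gt z < 0" "gs z > 0" "T z > 0" if "z \<in> thermal_range" for z
    using that thermal_range_subset energy_domainD(1) state_signs
    by (cases z; force simp: gt_def gs_def T_def)+
  have "continuous_on energy_domain gt" "continuous_on energy_domain gs" "continuous_on energy_domain T"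
    unfolding gt_def gs_def T_def
    by (intro continuous_on_constitutive_energy continuous_constitutive)+
  then have cont: "continuous_on thermal_range gt" "continuous_on thermal_range (\<lambda>z. gs z / T z)"
    using thermal_range_subset signs(3)
    by (auto intro!: continuous_on_divide intro: continuous_on_subset simp: less_imp_neq[symmetric])
  from continuous_attains_sup[OF compact_thermal_range False cont(1)]
  obtain a where a: "a > 0" "\<And>z. z \<in> thermal_range \<Longrightarrow> gt z \<le> - a"
    using signs(1) by (metis minus_minus neg_0_less_iff_less)
  from continuous_attains_sup[OF compact_thermal_range False cont(2)]
  obtain b where b: "b > 0" "\<And>z. z \<in> thermal_range \<Longrightarrow> gs z / T z \<le> b"
    using signs(2,3) by (metis divide_pos_pos)
  define m where "m = min (a / (b * K)) (a / 2)"
  have m_le: "m \<le> a / (b * K)" "m \<le> a / 2" unfolding m_def by (rule min.cobounded1, rule min.cobounded2)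
  have "m > 0" using a(1) b(1) K by (simp add: m_def)
  moreover have "m * (\<tau>\<^sub>1 - \<tau>\<^sub>0) \<le> press \<tau>\<^sub>0 e\<^sub>0 - press \<tau>\<^sub>1 e\<^sub>1"
    if ends: "(\<tau>\<^sub>0, e\<^sub>0) \<in> thermal_range" "(\<tau>\<^sub>1, e\<^sub>1) \<in> thermal_range" and less: "\<tau>\<^sub>0 < \<tau>\<^sub>1"
      and hug: "e\<^sub>1 = e\<^sub>0 - (press \<tau>\<^sub>0 e\<^sub>0 + press \<tau>\<^sub>1 e\<^sub>1) / 2 * (\<tau>\<^sub>1 - \<tau>\<^sub>0)"
      and le: "press \<tau>\<^sub>1 e\<^sub>1 \<le> press \<tau>\<^sub>0 e\<^sub>0" for \<tau>\<^sub>0 e\<^sub>0 \<tau>\<^sub>1 e\<^sub>1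
  proof -
    define pm where "pm = (press \<tau>\<^sub>0 e\<^sub>0 + press \<tau>\<^sub>1 e\<^sub>1) / 2"
    define e where "e t = e\<^sub>0 - pm * (t - \<tau>\<^sub>0)" for t
    define q where "q t = press t (e t) - pm" for t
    have e_ends: "e \<tau>\<^sub>0 = e\<^sub>0" "e \<tau>\<^sub>1 = e\<^sub>1" using hug by (simp_all add: e_def pm_def)
    have q_ends: "q \<tau>\<^sub>1 = - q \<tau>\<^sub>0" "2 * q \<tau>\<^sub>0 = press \<tau>\<^sub>0 e\<^sub>0 - press \<tau>\<^sub>1 e\<^sub>1"
      using e_ends by (auto simp: q_def pm_def field_simps)
    \<comment> \<open>The Hugoniot relation says that the graph of \<open>e\<close> is the chord.\<close>
    have chord: "(t, e t) \<in> thermal_range" if "t \<in> {\<tau>\<^sub>0..\<tau>\<^sub>1}" for t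
    proof -
      define u where "u = (t - \<tau>\<^sub>0) / (\<tau>\<^sub>1 - \<tau>\<^sub>0)"
      have "u \<ge> 0" "u \<le> 1" and tu: "t = \<tau>\<^sub>0 + u * (\<tau>\<^sub>1 - \<tau>\<^sub>0)"
        using that less by (auto simp: u_def field_simps)
      have "(t, e t) = (1 - u) *\<^sub>R (\<tau>\<^sub>0, e\<^sub>0) + u *\<^sub>R (\<tau>\<^sub>1, e\<^sub>1)"
        unfolding e_ends(2)[symmetric] by (simp add: e_def tu algebra_simps)
      then show ?thesis
        using convexD[OF convex_thermal_range ends, of "1 - u" u] \<open>u \<ge> 0\<close> \<open>u \<le> 1\<close>
        by (simp only:)
    qed
    have der: "(q has_real_derivative gt (t, e t) + gs (t, e t) / T (t, e t) * q t) (at t within {\<tau>\<^sub>0..\<tau>\<^sub>1})"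
      if t: "t \<in> {\<tau>\<^sub>0..\<tau>\<^sub>1}" for t
    proof -
      have dom: "(t, e t) \<in> energy_domain" using chord[OF t] thermal_range_subset by blast
      have "((\<lambda>t. (t, e t)) has_derivative (\<lambda>h. (h, - pm * h))) (at t)"
        unfolding e_def by (auto intro!: derivative_eq_intros)
      from has_derivative_compose[OF this ent_has_derivative[OF dom]]
      have "((\<lambda>t. (t, ent t (e t))) has_derivative
          (\<lambda>h. (h, (- pm * h + press t (e t) * h) / T (t, e t)))) (at t)"
        by (simp add: T_def)
      from has_derivative_compose[OF this pres_has_derivative[OF energy_domainD(1)[OF dom]]]
      have "((\<lambda>t. press t (e t)) has_derivative
          (\<lambda>h. gt (t, e t) * h + gs (t, e t) * ((- pm * h + press t (e t) * h) / T (t, e t)))) (at t)"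
        by (simp add: gt_def gs_def press_def)
      moreover have "(\<lambda>h. gt (t, e t) * h + gs (t, e t) * ((- pm * h + press t (e t) * h) / T (t, e t)))
          = (*) (gt (t, e t) + gs (t, e t) / T (t, e t) * q t)"
        using signs(3)[OF chord[OF t]] by (auto simp: q_def fun_eq_iff field_simps)
      ultimately have "((\<lambda>t. press t (e t)) has_real_derivative
          gt (t, e t) + gs (t, e t) / T (t, e t) * q t) (at t)"
        by (simp add: has_field_derivative_def)
      then have "((\<lambda>t. press t (e t) - pm) has_real_derivative
          gt (t, e t) + gs (t, e t) / T (t, e t) * q t - 0) (at t)"
        by (intro DERIV_diff DERIV_const)
      then show ?thesis by (simp add: q_def[abs_def] has_field_derivative_at_within)
    qed
    have "gt (t, e t) + gs (t, e t) / T (t, e t) * q t \<le> - a + b * \<bar>q t\<bar>" if "t \<in> {\<tau>\<^sub>0..\<tau>\<^sub>1}" for t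
    proof -
      note z = chord[OF that]
      have "gs (t, e t) / T (t, e t) * q t \<le> gs (t, e t) / T (t, e t) * \<bar>q t\<bar>"
        using signs(2,3)[OF z] by (intro mult_left_mono) auto
      also have "\<dots> \<le> b * \<bar>q t\<bar>" using b(2)[OF z] by (intro mult_right_mono) auto
      finally show ?thesis using a(2)[OF z] by simp
    qed
    from antisymmetric_drop_lower_bound[OF less a(1) b(1) der this q_ends(1)]
    have *: "min (a / b) (a / 2 * (\<tau>\<^sub>1 - \<tau>\<^sub>0)) \<le> 2 * q \<tau>\<^sub>0" using q_ends(2) le by simp
    have "\<tau>\<^sub>1 \<le> K" "1 / K \<le> \<tau>\<^sub>0" using ends by (auto simp: thermal_range_def)
    moreover have "1 / K > 0" using K by simp
    ultimately have "\<tau>\<^sub>1 - \<tau>\<^sub>0 \<le> K" by linarith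
    have "m * (\<tau>\<^sub>1 - \<tau>\<^sub>0) \<le> a / (b * K) * (\<tau>\<^sub>1 - \<tau>\<^sub>0)"
      using less m_le by (intro mult_right_mono) linarith+
    also have "\<dots> \<le> a / (b * K) * K"
      using \<open>\<tau>\<^sub>1 - \<tau>\<^sub>0 \<le> K\<close> a(1) b(1) K by (intro mult_left_mono) auto
    also have "\<dots> = a / b" using K by simp
    finally have "m * (\<tau>\<^sub>1 - \<tau>\<^sub>0) \<le> a / b" .
    moreover have "m * (\<tau>\<^sub>1 - \<tau>\<^sub>0) \<le> a / 2 * (\<tau>\<^sub>1 - \<tau>\<^sub>0)"
      using less m_le by (intro mult_right_mono) linarith+
    ultimately show ?thesis using * q_ends(2) by simp
  qed
  ultimately show ?thesis by blast
qed

end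

section \<open>Fluxes across a ray\<close>

text \<open>The component of the velocity along the clockwise normal
  \<open>(sin \<theta>, - cos \<theta>)\<close> of the ray at angle \<open>\<theta>\<close>;
  \<open>rvel\<close> below is the component along the ray.\<close>

definition nvel :: "real \<Rightarrow> real^4 \<Rightarrow> real" where
  "nvel \<theta> V = xvel V * sin \<theta> - yvel V * cos \<theta>"

definition rvel :: "real \<Rightarrow> real^4 \<Rightarrow> real" where
  "rvel \<theta> V = xvel V * cos \<theta> + yvel V * sin \<theta>"

lemma xvel_yvel_polar:
  "xvel V = nvel \<theta> V * sin \<theta> + rvel \<theta> V * cos \<theta>"
  "yvel V = rvel \<theta> V * sin \<theta> - nvel \<theta> V * cos \<theta>"
proof -
  have "(sin \<theta>)\<^sup>2 + (cos \<theta>)\<^sup>2 = 1" by simp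
  then show "xvel V = nvel \<theta> V * sin \<theta> + rvel \<theta> V * cos \<theta>"
    "yvel V = rvel \<theta> V * sin \<theta> - nvel \<theta> V * cos \<theta>"
    unfolding nvel_def rvel_def by algebra+
qed

lemma speed_polar: "(xvel V)\<^sup>2 + (yvel V)\<^sup>2 = (nvel \<theta> V)\<^sup>2 + (rvel \<theta> V)\<^sup>2"
proof -
  have "(sin \<theta>)\<^sup>2 + (cos \<theta>)\<^sup>2 = 1" by simp
  then show ?thesis unfolding nvel_def rvel_def by algebra
qed

lemma phase_space_rho_pos: "K > 1 \<Longrightarrow> V \<in> phase_space K \<Longrightarrow> rho V > 0"
  unfolding phase_space_def by (smt (verit) divide_pos_pos mem_Collect_eq)

lemma total_energy_polar:
  assumes "rho V > 0"
  shows "total_energy V = rho V * (internal_energy V + ((nvel \<theta> V)\<^sup>2 + (rvel \<theta> V)\<^sup>2) / 2)"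
  using assms unfolding internal_energy_def speed_polar[of V \<theta>] by simp

lemma state_eqI:
  assumes "rho V > 0" "tau V = tau W" "nvel \<theta> V = nvel \<theta> W" "rvel \<theta> V = rvel \<theta> W"
    and "internal_energy V = internal_energy W"
  shows "V = W"
proof -
  have rho: "rho W = rho V" using assms(1,2) by (auto simp: tau_def)
  have vel: "xvel V = xvel W" "yvel V = yvel W"
    using assms(3,4) by (simp_all add: xvel_yvel_polar[of _ \<theta>])
  have "total_energy V = total_energy W"
    using total_energy_polar[of V \<theta>] total_energy_polar[of W \<theta>] assms rho by simp
  then show ?thesis
    using rho vel assms(1) unfolding vec_eq_iff forall_4
    by (auto simp: rho_def xvel_def yvel_def total_energy_def)
qed

text \<open>The self-similar balance law states that the derivative of \<open>ray_flux\<close> in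
  \<open>\<theta>\<close> along a solution is \<open>radial_flux\<close>.\<close>

definition ray_flux :: "eos \<Rightarrow> real \<Rightarrow> real^4 \<Rightarrow> real^4" where
  "ray_flux Q \<theta> V = sin \<theta> *\<^sub>R xflux Q V - cos \<theta> *\<^sub>R yflux Q V"

definition radial_flux :: "eos \<Rightarrow> real \<Rightarrow> real^4 \<Rightarrow> real^4" where
  "radial_flux Q \<theta> V = cos \<theta> *\<^sub>R xflux Q V + sin \<theta> *\<^sub>R yflux Q V"

lemma ray_flux_mass: "ray_flux Q \<theta> V $ 1 = rho V * nvel \<theta> V"
  by (simp add: ray_flux_def xflux_def yflux_def nvel_def algebra_simps)

lemma ray_flux_normal_momentum:
  "ray_flux Q \<theta> V $ 2 * sin \<theta> - ray_flux Q \<theta> V $ 3 * cos \<theta> = rho V * (nvel \<theta> V)\<^sup>2 + pressure Q V"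
proof -
  have "(sin \<theta>)\<^sup>2 + (cos \<theta>)\<^sup>2 = 1" by simp
  then show ?thesis
    unfolding ray_flux_def xflux_def yflux_def nvel_def vector_minus_component
      vector_scaleR_component vector_4_nth real_scaleR_def by algebra
qed

lemma ray_flux_radial_momentum:
  "ray_flux Q \<theta> V $ 2 * cos \<theta> + ray_flux Q \<theta> V $ 3 * sin \<theta> = rho V * nvel \<theta> V * rvel \<theta> V"
  unfolding ray_flux_def xflux_def yflux_def nvel_def rvel_def vector_minus_component
    vector_scaleR_component vector_4_nth real_scaleR_def by algebra

lemma ray_flux_energy: "ray_flux Q \<theta> V $ 4 = nvel \<theta> V * (total_energy V + pressure Q V)"
  by (simp add: ray_flux_def xflux_def yflux_def nvel_def algebra_simps)

lemma radial_flux_mass: "radial_flux Q \<theta> V $ 1 = rho V * rvel \<theta> V"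
  by (simp add: radial_flux_def xflux_def yflux_def rvel_def algebra_simps)

lemma radial_flux_momentum:
  "radial_flux Q \<theta> V $ 2 * cos \<theta> + radial_flux Q \<theta> V $ 3 * sin \<theta> = rho V * (rvel \<theta> V)\<^sup>2 + pressure Q V"
proof -
  have "(sin \<theta>)\<^sup>2 + (cos \<theta>)\<^sup>2 = 1" by simp
  then show ?thesis
    unfolding radial_flux_def xflux_def yflux_def rvel_def vector_add_component
      vector_scaleR_component vector_4_nth real_scaleR_def by algebra
qed

context gas
begin

lemma pressure_eq_press: "pressure Q V = press (tau V) (internal_energy V)"
  by (simp add: pressure_def press_def entropy_def ent_def)

lemma rho_pos: "V \<in> phase_space K \<Longrightarrow> rho V > 0"
  using phase_space_rho_pos K by blast

text \<open>The jump conditions say that \<open>M\<close>, \<open>M L\<close>,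
  \<open>p + M\<^sup>2 \<tau>\<close> and
  \<open>M (e + (M \<tau>)\<^sup>2 / 2 + L\<^sup>2 / 2 + p \<tau>)\<close> agree on both sides, using
  \<open>N = M \<tau>\<close>. Division by \<open>M \<noteq> 0\<close> yields \<open>[L] = 0\<close>, and
  the elimination of \<open>M\<^sup>2\<close> from the third and fourth condition yields the Hugoniot
  relation. If the volumes agreed, all other variables would agree as well, so there is a genuine chord
  to which the slope bound applies.\<close>

lemma mass_flux_across_discontinuity:
  "\<exists>m>0. \<forall>\<theta> V W. V \<in> phase_space K \<longrightarrow> W \<in> phase_space K \<longrightarrow> V \<noteq> W \<longrightarrow> nvel \<theta> V \<noteq> 0 \<longrightarrow>
    ray_flux Q \<theta> V = ray_flux Q \<theta> W \<longrightarrow> m \<le> \<bar>rho V * nvel \<theta> V\<bar>"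
proof -
  obtain m where m: "m > 0" and slope:
    "\<And>\<tau>\<^sub>0 e\<^sub>0 \<tau>\<^sub>1 e\<^sub>1. \<lbrakk>(\<tau>\<^sub>0, e\<^sub>0) \<in> thermal_range; (\<tau>\<^sub>1, e\<^sub>1) \<in> thermal_range; \<tau>\<^sub>0 < \<tau>\<^sub>1;
      e\<^sub>1 = e\<^sub>0 - (press \<tau>\<^sub>0 e\<^sub>0 + press \<tau>\<^sub>1 e\<^sub>1) / 2 * (\<tau>\<^sub>1 - \<tau>\<^sub>0);
      press \<tau>\<^sub>1 e\<^sub>1 \<le> press \<tau>\<^sub>0 e\<^sub>0\<rbrakk> \<Longrightarrow>
      m * (\<tau>\<^sub>1 - \<tau>\<^sub>0) \<le> press \<tau>\<^sub>0 e\<^sub>0 - press \<tau>\<^sub>1 e\<^sub>1"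
    using hugoniot_chord_slope_bound by auto
  have "sqrt m \<le> \<bar>rho V * nvel \<theta> V\<bar>"
    if V: "V \<in> phase_space K" and W: "W \<in> phase_space K" and "V \<noteq> W" and nz: "nvel \<theta> V \<noteq> 0"
      and flux: "ray_flux Q \<theta> V = ray_flux Q \<theta> W" for \<theta> V W
  proof -
    define M where "M = rho V * nvel \<theta> V"
    define p p' where "p = press (tau V) (internal_energy V)" and "p' = press (tau W) (internal_energy W)"
    have pos: "rho V > 0" "rho W > 0" using V W rho_pos by auto
    have "M \<noteq> 0" using nz pos by (simp add: M_def)
    have MW: "M = rho W * nvel \<theta> W"
      using arg_cong[OF flux, of "\<lambda>F. F $ 1"] by (simp add: ray_flux_mass M_def)
    have nV: "nvel \<theta> V = M * tau V" using pos by (simp add: tau_def M_def)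
    have nW: "nvel \<theta> W = M * tau W" using pos by (simp add: tau_def MW)
    have radial: "rvel \<theta> V = rvel \<theta> W"
      using arg_cong[OF flux, of "\<lambda>F. F $ 2 * cos \<theta> + F $ 3 * sin \<theta>"] \<open>M \<noteq> 0\<close>
      unfolding ray_flux_radial_momentum M_def[symmetric] MW[symmetric] by simp
    have "rho V * (nvel \<theta> V)\<^sup>2 = M * (M * tau V)" "rho W * (nvel \<theta> W)\<^sup>2 = M * (M * tau W)"
      unfolding nV[symmetric] nW[symmetric] by (simp_all add: M_def MW[unfolded M_def] power2_eq_square)
    then have jump: "p - p' = M\<^sup>2 * (tau W - tau V)"
      using arg_cong[OF flux, of "\<lambda>F. F $ 2 * sin \<theta> - F $ 3 * cos \<theta>"]
      unfolding ray_flux_normal_momentum pressure_eq_press p_def[symmetric] p'_def[symmetric]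
      by (simp add: power2_eq_square algebra_simps)
    have enthalpy: "nvel \<theta> X * (total_energy X + pressure Q X) =
        M * (internal_energy X + (M * tau X)\<^sup>2 / 2 + (rvel \<theta> X)\<^sup>2 / 2
          + press (tau X) (internal_energy X) * tau X)"
      if "rho X > 0" "nvel \<theta> X = M * tau X" for X
      using that(1) unfolding total_energy_polar[OF that(1), of \<theta>] pressure_eq_press that(2)
      by (simp add: tau_def field_simps)
    have "internal_energy V + (M * tau V)\<^sup>2 / 2 + p * tau V =
        internal_energy W + (M * tau W)\<^sup>2 / 2 + p' * tau W"
      using arg_cong[OF flux, of "\<lambda>F. F $ 4"] \<open>M \<noteq> 0\<close> radial
      unfolding ray_flux_energy enthalpy[OF pos(1) nV] enthalpy[OF pos(2) nW]
      by (simp add: p_def p'_def)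
    then have hug: "internal_energy W = internal_energy V - (p + p') / 2 * (tau W - tau V)"
      using jump by algebra
    have "tau V \<noteq> tau W"
    proof
      assume eq: "tau V = tau W"
      then have "internal_energy V = internal_energy W" using hug by simp
      then have "V = W"
        using state_eqI[OF pos(1) eq _ radial] nV nW eq by simp
      with \<open>V \<noteq> W\<close> show False by simp
    qed
    have "m \<le> M\<^sup>2"
    proof (cases "tau V < tau W")
      case True
      then have "p' \<le> p" using jump by (metis diff_ge_0_iff_ge less_imp_le mult_nonneg_nonneg zero_le_power2)
      then have "m * (tau W - tau V) \<le> p - p'"
        using slope[OF phase_space_thermal[OF V] phase_space_thermal[OF W] True] hug
        unfolding p_def[symmetric] p'_def[symmetric] by simp
      then show ?thesis using True unfolding jump by (simp add: mult_le_cancel_right)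
    next
      case False
      then have less: "tau W < tau V" using \<open>tau V \<noteq> tau W\<close> by simp
      have jump': "p' - p = M\<^sup>2 * (tau V - tau W)" using jump by (simp add: algebra_simps)
      then have "p \<le> p'" using less by (metis diff_ge_0_iff_ge less_imp_le mult_nonneg_nonneg zero_le_power2)
      moreover have "internal_energy V = internal_energy W - (p' + p) / 2 * (tau V - tau W)"
        using hug by algebra
      ultimately have "m * (tau V - tau W) \<le> p' - p"
        using slope[OF phase_space_thermal[OF W] phase_space_thermal[OF V] less]
        unfolding p_def[symmetric] p'_def[symmetric] by simp
      then show ?thesis using less unfolding jump' by (simp add: mult_le_cancel_right)
    qed
    then show ?thesis unfolding M_def[symmetric] by (metis real_sqrt_abs real_sqrt_le_mono)
  qed
  with m show ?thesis by (intro exI[of _ "sqrt m"]) simp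
qed

lemma continuous_on_rho: "continuous_on A rho"
  unfolding rho_def[abs_def] by (intro continuous_intros)

lemma continuous_on_state_variables:
  assumes "\<And>V. V \<in> A \<Longrightarrow> rho V > 0"
  shows "continuous_on A tau" "continuous_on A xvel" "continuous_on A yvel"
    "continuous_on A internal_energy"
proof -
  note [continuous_intros] = continuous_on_rho
  have nz: "\<forall>V\<in>A. rho V \<noteq> 0" using assms by force
  show "continuous_on A tau" "continuous_on A xvel" "continuous_on A yvel"
    unfolding tau_def[abs_def] xvel_def[abs_def] yvel_def[abs_def] using nz
    by (intro continuous_intros; simp)+
  note [continuous_intros] = this(2,3)
  show "continuous_on A internal_energy"
    unfolding internal_energy_def[abs_def] total_energy_def[abs_def] using nz
    by (intro continuous_intros; simp)
qed

lemma compact_phase_space: "compact (phase_space K)"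
proof -
  define A where "A = {V. 1 / K \<le> rho V \<and> rho V \<le> K} \<inter> cball 0 K"
  have "closed A"
    unfolding A_def rho_def
    by (intro closed_Int closed_Collect_conj closed_Collect_le continuous_intros closed_cball)
  moreover have "rho V > 0" if "V \<in> A" for V
    using that K unfolding A_def by (smt (verit) IntD1 divide_pos_pos mem_Collect_eq)
  ultimately have "closed (A \<inter> internal_energy -` {1 / K..K})"
    by (intro continuous_closed_preimage continuous_on_state_variables(4)) auto
  moreover have "phase_space K = A \<inter> internal_energy -` {1 / K..K}"
    by (auto simp: phase_space_def A_def)
  moreover have "bounded A" by (auto simp: A_def intro: bounded_subset[OF bounded_cball])
  ultimately show ?thesis
    by (metis bounded_Int compact_eq_bounded_closed)
qed

lemma continuous_on_fluxes:
  "continuous_on (phase_space K) (xflux Q)" "continuous_on (phase_space K) (yflux Q)"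
proof -
  have "continuous_on (phase_space K) (\<lambda>V. (\<lambda>(\<tau>, e). press \<tau> e) (tau V, internal_energy V))"
    by (rule continuous_on_compose2[OF continuous_on_press])
      (use phase_space_thermal thermal_range_subset rho_pos in
        \<open>auto intro!: continuous_on_Pair continuous_on_state_variables\<close>)
  then have p: "continuous_on (phase_space K) (pressure Q)"
    by (simp add: pressure_eq_press[abs_def])
  have E: "continuous_on (phase_space K) total_energy"
    unfolding total_energy_def[abs_def] by (intro continuous_intros)
  note [continuous_intros] = p E continuous_on_rho
    continuous_on_state_variables(2,3)[of "phase_space K", OF rho_pos]
  have "continuous_on (phase_space K) (\<lambda>V. xflux Q V $ i)" for i
    using exhaust_4[of i] unfolding xflux_def
    by (elim disjE; simp only: vector_4_nth; intro continuous_intros)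
  then have "continuous_on (phase_space K) (\<lambda>V. \<chi> i. xflux Q V $ i)"
    by (rule continuous_on_vec_lambda)
  then show "continuous_on (phase_space K) (xflux Q)" by simp
  have "continuous_on (phase_space K) (\<lambda>V. yflux Q V $ i)" for i
    using exhaust_4[of i] unfolding yflux_def
    by (elim disjE; simp only: vector_4_nth; intro continuous_intros)
  then have "continuous_on (phase_space K) (\<lambda>V. \<chi> i. yflux Q V $ i)"
    by (rule continuous_on_vec_lambda)
  then show "continuous_on (phase_space K) (yflux Q)" by simp
qed

lemma radial_flux_bound:
  "\<exists>B>0. \<forall>\<theta> V. V \<in> phase_space K \<longrightarrow> norm (radial_flux Q \<theta> V) \<le> B"
proof -
  have "bounded (xflux Q ` phase_space K)" "bounded (yflux Q ` phase_space K)"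
    by (intro compact_imp_bounded compact_continuous_image continuous_on_fluxes compact_phase_space)+
  then obtain b c where b: "b > 0" "\<And>V. V \<in> phase_space K \<Longrightarrow> norm (xflux Q V) \<le> b"
    and c: "c > 0" "\<And>V. V \<in> phase_space K \<Longrightarrow> norm (yflux Q V) \<le> c"
    unfolding bounded_pos by blast
  have "norm (radial_flux Q \<theta> V) \<le> b + c" if V: "V \<in> phase_space K" for \<theta> V
  proof -
    have "norm (radial_flux Q \<theta> V) \<le> \<bar>cos \<theta>\<bar> * norm (xflux Q V) + \<bar>sin \<theta>\<bar> * norm (yflux Q V)"
      unfolding radial_flux_def by (metis norm_scaleR norm_triangle_ineq)
    also have "\<dots> \<le> 1 * b + 1 * c"
      using b(2)[OF V] c(2)[OF V] by (intro add_mono mult_mono) auto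
    finally show ?thesis by simp
  qed
  with b(1) c(1) show ?thesis by (intro exI[of _ "b + c"]) simp
qed

end

section \<open>Zeros of the mass flux in smooth flow\<close>

lemma mvt_bound:
  fixes f :: "real \<Rightarrow> real"
  assumes "a \<le> b" "continuous_on {a..b} f"
    and der: "\<And>t. \<lbrakk>a < t; t < b\<rbrakk> \<Longrightarrow> (f has_real_derivative f' t) (at t)"
    and bound: "\<And>t. \<lbrakk>a < t; t < b\<rbrakk> \<Longrightarrow> \<bar>f' t\<bar> \<le> C"
  shows "\<bar>f b - f a\<bar> \<le> C * (b - a)"
proof (cases "a = b")
  case False
  then have "a < b" using assms by simp
  moreover have "f differentiable (at t)" if "a < t" "t < b" for t
    using der[OF that] real_differentiable_def by blast
  ultimately obtain l z where z: "a < z" "z < b" "DERIV f z :> l" "f b - f a = (b - a) * l"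
    using MVT[of a b f] assms by blast
  then have "\<bar>l\<bar> \<le> C" using DERIV_unique[OF der z(3)] bound by blast
  then show ?thesis using z(4) \<open>a < b\<close> by (simp add: abs_mult mult.commute)
qed simp

text \<open>By Rolle's theorem and \<open>M' = r L\<close>, the function \<open>L\<close> vanishes at
  some \<open>\<xi>\<close> between the zeros of \<open>M\<close>. If \<open>q\<close> is the maximum of
  \<open>|L|\<close> before \<open>\<xi>\<close>, then \<open>|M| \<le> K q (b - a)\<close> there, hence
  \<open>|L'| \<le> K\<^sup>2 q (b - a)\<close>, and \<open>L\<close> can fall from \<open>q\<close> to
  zero only if \<open>q \<le> K\<^sup>2 q (b - a)\<^sup>2\<close>.\<close>

lemma zero_gap:
  fixes M L :: "real \<Rightarrow> real"
  assumes "a < b" "K > 0" "M a = 0" "M b = 0" "L a \<noteq> 0"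
    and contM: "continuous_on {a..b} M" and contL: "continuous_on {a..<b} L"
    and M': "\<And>t. \<lbrakk>a < t; t < b\<rbrakk> \<Longrightarrow> (M has_real_derivative r t * L t) (at t)"
    and L': "\<And>t. \<lbrakk>a < t; t < b\<rbrakk> \<Longrightarrow> (L has_real_derivative - N t) (at t)"
    and r: "\<And>t. \<lbrakk>a < t; t < b\<rbrakk> \<Longrightarrow> 0 < r t \<and> r t \<le> K"
    and N: "\<And>t. \<lbrakk>a < t; t < b\<rbrakk> \<Longrightarrow> \<bar>N t\<bar> \<le> K * \<bar>M t\<bar>"
  shows "1 / K \<le> b - a"
proof -
  have "M differentiable (at t)" if "a < t" "t < b" for t
    using M'[OF that] real_differentiable_def by blast
  then obtain \<xi> where \<xi>: "a < \<xi>" "\<xi> < b" "DERIV M \<xi> :> 0"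
    using Rolle[OF \<open>a < b\<close> _ contM] assms(3,4) by metis
  then have "L \<xi> = 0" using DERIV_unique[OF M'] r[of \<xi>] by fastforce
  have "continuous_on {a..\<xi>} (\<lambda>t. \<bar>L t\<bar>)"
    using \<xi> by (intro continuous_intros continuous_on_subset[OF contL]) auto
  from continuous_attains_sup[OF compact_Icc _ this]
  obtain \<eta> where \<eta>: "a \<le> \<eta>" "\<eta> \<le> \<xi>" and sup: "\<And>t. \<lbrakk>a \<le> t; t \<le> \<xi>\<rbrakk> \<Longrightarrow> \<bar>L t\<bar> \<le> \<bar>L \<eta>\<bar>"
    using \<xi> by auto
  define q where "q = \<bar>L \<eta>\<bar>"
  have "q > 0" using sup[of a] \<xi> \<open>L a \<noteq> 0\<close> by (auto simp: q_def)
  have M_bound: "\<bar>M t\<bar> \<le> K * q * (b - a)" if "a < t" "t < \<xi>" for t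
  proof -
    have "\<bar>M t - M a\<bar> \<le> K * q * (t - a)"
    proof (rule mvt_bound[where f' = "\<lambda>t. r t * L t"])
      show "continuous_on {a..t} M" using that \<xi> by (intro continuous_on_subset[OF contM]) auto
      fix s assume s: "a < s" "s < t"
      show "(M has_real_derivative r s * L s) (at s)" using M' s that \<xi> by simp
      have "\<bar>r s\<bar> * \<bar>L s\<bar> \<le> K * q"
        using r[of s] sup[of s] s that \<xi> unfolding q_def by (intro mult_mono) auto
      then show "\<bar>r s * L s\<bar> \<le> K * q" by (simp add: abs_mult)
    qed (use that in auto)
    also have "\<dots> \<le> K * q * (b - a)"
      using that \<xi> \<open>K > 0\<close> \<open>q > 0\<close> by (intro mult_left_mono) auto
    finally show ?thesis using \<open>M a = 0\<close> by simp
  qed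
  have "\<bar>L \<xi> - L \<eta>\<bar> \<le> K * (K * q * (b - a)) * (\<xi> - \<eta>)"
  proof (rule mvt_bound[where f' = "\<lambda>t. - N t"])
    show "continuous_on {\<eta>..\<xi>} L" using \<eta> \<xi> by (intro continuous_on_subset[OF contL]) auto
    fix t assume t: "\<eta> < t" "t < \<xi>"
    show "(L has_real_derivative - N t) (at t)" using L' t \<eta> \<xi> by simp
    have "\<bar>N t\<bar> \<le> K * \<bar>M t\<bar>" using N t \<eta> \<xi> by simp
    also have "\<dots> \<le> K * (K * q * (b - a))"
      using M_bound t \<eta> \<open>K > 0\<close> by (intro mult_left_mono) auto
    finally show "\<bar>- N t\<bar> \<le> K * (K * q * (b - a))" by simp
  qed (use \<eta> in auto)
  also have "\<dots> \<le> K * (K * q * (b - a)) * (b - a)"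
    using \<eta> \<xi> \<open>K > 0\<close> \<open>q > 0\<close> \<open>a < b\<close> by (intro mult_left_mono) auto
  finally have "q * 1 \<le> q * (K * (b - a))\<^sup>2"
    using \<open>L \<xi> = 0\<close> by (simp add: q_def power2_eq_square algebra_simps)
  then have "1\<^sup>2 \<le> (K * (b - a))\<^sup>2" using \<open>q > 0\<close> by (simp only: mult_le_cancel_left_pos) simp
  then have "1 \<le> K * (b - a)"
    by (rule power2_le_imp_le) (use \<open>K > 0\<close> \<open>a < b\<close> in simp)
  then show ?thesis using \<open>K > 0\<close> by (simp add: field_simps)
qed

text \<open>An infinite bounded set has a limit point, near which two of its points are arbitrarily
  close.\<close>

lemma finite_separated:
  fixes S :: "real set"
  assumes "d > 0" "bounded S" and sep: "\<And>x y. \<lbrakk>x \<in> S; y \<in> S; x < y\<rbrakk> \<Longrightarrow> d \<le> y - x"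
  shows "finite S"
proof (rule ccontr)
  assume inf: "infinite S"
  have "compact (closure S)" using assms(2) by simp
  then obtain l where "l islimpt S"
    using inf closure_subset Heine_Borel_imp_Bolzano_Weierstrass by metis
  then have "infinite (S \<inter> ball l (d / 2))" using \<open>d > 0\<close> by (simp add: islimpt_eq_infinite_ball)
  then obtain x where x: "x \<in> S \<inter> ball l (d / 2)"
    by (metis finite.emptyI ex_in_conv)
  then have "infinite (S \<inter> ball l (d / 2) - {x})" using \<open>infinite (S \<inter> _)\<close> by simp
  then obtain y where y: "y \<in> S \<inter> ball l (d / 2)" "y \<noteq> x"
    by (metis Diff_iff finite.emptyI ex_in_conv singletonI)
  have "dist x y < d" using x y dist_triangle_half_r[of l x d y] by (auto simp: dist_commute)
  with sep[of x y] sep[of y x] x y show False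
    by (cases x y rule: linorder_cases) (auto simp: dist_real_def)
qed

section \<open>Regularity along a solution\<close>

locale flow = gas +
  fixes U :: "real \<Rightarrow> real^4"
  assumes sol: "steady_selfsimilar_entropy_solution Q K U"
    and nostag: "no_stagnation_points U"
    and rcont: "right_continuous_version U"
begin

definition mass_flux :: "real \<Rightarrow> real" where "mass_flux \<theta> = rho (U \<theta>) * nvel \<theta> (U \<theta>)"

lemma in_phase: "U \<theta> \<in> phase_space K"
  using sol by (simp add: steady_selfsimilar_entropy_solution_def)

lemma normal_velocity_zero_iff: "normal_velocity U \<theta> = 0 \<longleftrightarrow> mass_flux \<theta> = 0"
  using rho_pos[OF in_phase[of \<theta>]] by (simp add: mass_flux_def normal_velocity_def nvel_def)

lemma balance:
  assumes "x \<le> y"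
  shows "ray_flux Q y (U y) = ray_flux Q x (U x) + integral {x..y} (\<lambda>t. radial_flux Q t (U t))"
proof (cases "x = y")
  case False
  then have "ray_flux Q y (U y) - ray_flux Q x (U x) = integral {x..y} (\<lambda>t. radial_flux Q t (U t))"
    using sol assms by (simp add: steady_selfsimilar_entropy_solution_def ray_flux_def radial_flux_def)
  then show ?thesis by (metis add.commute diff_add_cancel)
qed simp

text \<open>The bounded integrand also settles the non-integrable case: the integral then has the default
  value zero, which obeys the same bound.\<close>

lemma ray_flux_lipschitz:
  assumes B: "\<And>\<theta> V. V \<in> phase_space K \<Longrightarrow> norm (radial_flux Q \<theta> V) \<le> B"
  shows "norm (ray_flux Q y (U y) - ray_flux Q x (U x)) \<le> B * \<bar>y - x\<bar>"
proof -
  have "B \<ge> 0" by (rule order_trans[OF norm_ge_zero B[OF in_phase]])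
  have *: "norm (ray_flux Q y (U y) - ray_flux Q x (U x)) \<le> B * (y - x)" if "x \<le> y" for x y
  proof (cases "(\<lambda>t. radial_flux Q t (U t)) integrable_on {x..y}")
    case True
    have "norm (integral {x..y} (\<lambda>t. radial_flux Q t (U t))) \<le> B * measure lborel {x..y}"
      by (rule has_integral_bound_real[OF \<open>B \<ge> 0\<close> finite.emptyI integrable_integral[OF True]])
        (simp add: B in_phase)
    then show ?thesis using balance[OF that] that by simp
  next
    case False
    then show ?thesis using balance[OF that] that \<open>B \<ge> 0\<close> by (simp add: not_integrable_integral)
  qed
  show ?thesis
    using *[of x y] *[of y x] by (cases "x \<le> y") (auto simp: norm_minus_commute)
qed

lemma mass_lipschitz:
  assumes B: "\<And>\<theta> V. V \<in> phase_space K \<Longrightarrow> norm (radial_flux Q \<theta> V) \<le> B"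
  shows "\<bar>mass_flux y - mass_flux x\<bar> \<le> B * \<bar>y - x\<bar>"
  using component_le_norm_cart[of "ray_flux Q y (U y) - ray_flux Q x (U x)" 1]
    ray_flux_lipschitz[OF B, of y x]
  by (simp add: ray_flux_mass mass_flux_def)

lemma tendsto_ray_flux:
  "((\<lambda>t. ray_flux Q t (U t)) \<longlongrightarrow> ray_flux Q \<theta> (U \<theta>)) (at \<theta>)"
proof -
  obtain B where B: "B > 0" "\<And>\<theta> V. V \<in> phase_space K \<Longrightarrow> norm (radial_flux Q \<theta> V) \<le> B"
    using radial_flux_bound by auto
  have lip: "norm (ray_flux Q t (U t) - ray_flux Q \<theta> (U \<theta>)) \<le> B * \<bar>t - \<theta>\<bar>" for t
    by (rule ray_flux_lipschitz) (rule B(2))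
  have "((\<lambda>t. B * \<bar>t - \<theta>\<bar>) \<longlongrightarrow> B * \<bar>\<theta> - \<theta>\<bar>) (at \<theta>)" by (intro tendsto_intros)
  then have "((\<lambda>t. B * \<bar>t - \<theta>\<bar>) \<longlongrightarrow> 0) (at \<theta>)" by simp
  then have "((\<lambda>t. ray_flux Q t (U t) - ray_flux Q \<theta> (U \<theta>)) \<longlongrightarrow> 0) (at \<theta>)"
    by (rule Lim_null_comparison[rotated]) (simp add: lip)
  then show ?thesis by (simp only: Lim_null[symmetric])
qed

lemma isCont_mass: "isCont mass_flux \<theta>"
proof -
  have "((\<lambda>t. ray_flux Q t (U t) $ 1) \<longlongrightarrow> ray_flux Q \<theta> (U \<theta>) $ 1) (at \<theta>)"
    by (intro tendsto_vec_nth tendsto_ray_flux)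
  then show ?thesis by (simp add: ray_flux_mass mass_flux_def[symmetric] isCont_def)
qed

text \<open>The flux across the ray is continuous in \<open>\<theta>\<close>, so its values at the left
  limit \<open>V\<close> and at the right limit \<open>U \<theta>\<close> agree.\<close>

lemma rankine_hugoniot:
  assumes "\<not> isCont U \<theta>"
  obtains V where "V \<in> phase_space K" "V \<noteq> U \<theta>" "ray_flux Q \<theta> (U \<theta>) = ray_flux Q \<theta> V"
proof -
  obtain V where V: "(U \<longlongrightarrow> V) (at_left \<theta>)"
    using rcont assms unfolding right_continuous_version_def by blast
  have "V \<in> phase_space K"
    by (rule Lim_in_closed_set[OF compact_imp_closed[OF compact_phase_space] _ _ V])
      (simp_all add: in_phase)
  moreover have "V \<noteq> U \<theta>"
  proof
    assume "V = U \<theta>"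
    moreover have "(U \<longlongrightarrow> U \<theta>) (at_right \<theta>)" using rcont by (simp add: right_continuous_version_def)
    ultimately have "isCont U \<theta>" using V by (simp add: isCont_def filterlim_split_at)
    with assms show False by simp
  qed
  moreover have "ray_flux Q \<theta> (U \<theta>) = ray_flux Q \<theta> V"
  proof (rule tendsto_unique[OF _ _ _])
    show "((\<lambda>t. ray_flux Q t (U t)) \<longlongrightarrow> ray_flux Q \<theta> (U \<theta>)) (at_left \<theta>)"
      by (rule filterlim_at_split[THEN iffD1, OF tendsto_ray_flux, THEN conjunct1])
    have "((\<lambda>t. xflux Q (U t)) \<longlongrightarrow> xflux Q V) (at_left \<theta>)"
      "((\<lambda>t. yflux Q (U t)) \<longlongrightarrow> yflux Q V) (at_left \<theta>)"
      using \<open>V \<in> phase_space K\<close> in_phase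
      by (intro continuous_on_tendsto_compose[OF continuous_on_fluxes(1) V]
          continuous_on_tendsto_compose[OF continuous_on_fluxes(2) V]; simp)+
    then show "((\<lambda>t. ray_flux Q t (U t)) \<longlongrightarrow> ray_flux Q \<theta> V) (at_left \<theta>)"
      unfolding ray_flux_def by (intro tendsto_intros)
  qed simp
  ultimately show ?thesis using that by blast
qed

lemma shock_mass_nonzero:
  assumes "shock U \<theta>"
  shows "\<not> isCont U \<theta>" "nvel \<theta> (U \<theta>) \<noteq> 0"
proof -
  have "normal_velocity U \<theta> \<noteq> 0"
    using assms unfolding shock_def forward_shock_def backward_shock_def
    by (auto dest: eventually_nhds_x_imp_x)
  then show "nvel \<theta> (U \<theta>) \<noteq> 0" by (simp add: normal_velocity_def nvel_def)
  show "\<not> isCont U \<theta>" using assms by (auto simp: shock_def forward_shock_def backward_shock_def)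
qed

text \<open>Because \<open>M\<close> is continuous even where \<open>U\<close> jumps, \<open>N\<close>
  keeps its sign near \<open>\<theta>\<close>.\<close>

lemma discontinuity_is_shock:
  assumes "\<not> isCont U \<theta>" "mass_flux \<theta> \<noteq> 0"
  shows "shock U \<theta>"
proof -
  have sgn: "normal_velocity U t > 0 \<longleftrightarrow> mass_flux t > 0" "normal_velocity U t < 0 \<longleftrightarrow> mass_flux t < 0" for t
    using rho_pos[OF in_phase[of t]]
    by (auto simp: mass_flux_def normal_velocity_def nvel_def[symmetric] zero_less_mult_iff mult_less_0_iff)
  have lim: "(mass_flux \<longlongrightarrow> mass_flux \<theta>) (nhds \<theta>)"
    using isCont_mass by (simp add: isCont_def tendsto_at_iff_tendsto_nhds)
  show ?thesis
  proof (cases "mass_flux \<theta> > 0")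
    case True
    then show ?thesis
      using order_tendstoD(1)[OF lim True] assms by (simp add: shock_def forward_shock_def sgn)
  next
    case False
    then have "mass_flux \<theta> < 0" using assms by simp
    then show ?thesis
      using order_tendstoD(2)[OF lim] assms by (simp add: shock_def backward_shock_def sgn)
  qed
qed

text \<open>Needed to differentiate the balance law at points at which \<open>U\<close> is merely
  one-sidedly continuous: nothing is known yet about the discontinuities nearby.\<close>

lemma integrable_radial_flux: "(\<lambda>t. radial_flux Q t (U t)) integrable_on {a..b}"
proof -
  obtain B where B: "\<And>\<theta> V. V \<in> phase_space K \<Longrightarrow> norm (radial_flux Q \<theta> V) \<le> B"
    using radial_flux_bound by auto
  have meas: "(\<lambda>t. f (U t)) \<in> borel_measurable lebesgue"
    if "continuous_on (phase_space K) f" for f :: "real^4 \<Rightarrow> real^4"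
  proof -
    \<comment> \<open>Cut off outside the closed set on which \<open>f\<close> is known to be continuous.\<close>
    have "phase_space K \<in> sets borel"
      by (intro borel_closed compact_imp_closed compact_phase_space)
    then have "(\<lambda>V. indicator (phase_space K) V *\<^sub>R f V) \<in> borel_measurable borel"
      using that by (intro borel_measurable_continuous_on_indicator) auto
    moreover have "U \<in> borel_measurable lebesgue"
      using sol by (simp add: steady_selfsimilar_entropy_solution_def)
    ultimately have "(\<lambda>t. indicator (phase_space K) (U t) *\<^sub>R f (U t)) \<in> borel_measurable lebesgue"
      by (rule measurable_compose[rotated])
    then show ?thesis by (simp add: in_phase)
  qed
  have "g \<in> borel_measurable lebesgue" if "continuous_on UNIV g" for g :: "real \<Rightarrow> real"
    by (rule measurable_completion) (use borel_measurable_continuous_onI[OF that] in simp)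
  then have [measurable]: "cos \<in> borel_measurable (lebesgue :: real measure)"
    "sin \<in> borel_measurable (lebesgue :: real measure)"
    by (simp_all add: continuous_on_cos continuous_on_sin)
  note [measurable] = meas[OF continuous_on_fluxes(1)] meas[OF continuous_on_fluxes(2)]
  have "(\<lambda>t. radial_flux Q t (U t)) \<in> borel_measurable lebesgue"
    unfolding radial_flux_def by measurable
  then have "(\<lambda>t. radial_flux Q t (U t)) \<in> borel_measurable (lebesgue_on {a..b})"
    by (rule measurable_restrict_space1)
  then show ?thesis
    by (rule measurable_bounded_by_integrable_imp_integrable[where g = "\<lambda>_. B"])
      (use B in_phase in auto)
qed

lemma ray_flux_has_derivative:
  assumes "x \<in> {a..b}" and cont: "continuous (at x within {a..b}) U"
  shows "((\<lambda>t. ray_flux Q t (U t)) has_vector_derivative radial_flux Q x (U x)) (at x within {a..b})"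
proof -
  have "continuous (at x within {a..b}) (\<lambda>t. f (U t))" if "continuous_on (phase_space K) f"
    for f :: "real^4 \<Rightarrow> real^4"
    using continuous_on_tendsto_compose[OF that, of U "U x" "at x within {a..b}"] cont in_phase
    by (simp add: continuous_within)
  from this[OF continuous_on_fluxes(1)] this[OF continuous_on_fluxes(2)]
  have "continuous (at x within {a..b}) (\<lambda>t. radial_flux Q t (U t))"
    unfolding radial_flux_def by (intro continuous_intros)
  then have "((\<lambda>u. integral {a..u} (\<lambda>t. radial_flux Q t (U t))) has_vector_derivative
      radial_flux Q x (U x)) (at x within ({a..b} - {}))"
    using assms(1) by (intro integral_has_vector_derivative_continuous_at integrable_radial_flux) auto
  then have "((\<lambda>u. ray_flux Q a (U a) + integral {a..u} (\<lambda>t. radial_flux Q t (U t)))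
      has_vector_derivative 0 + radial_flux Q x (U x)) (at x within {a..b})"
    by (intro has_vector_derivative_add has_vector_derivative_const) simp
  then have "((\<lambda>u. ray_flux Q a (U a) + integral {a..u} (\<lambda>t. radial_flux Q t (U t)))
      has_vector_derivative radial_flux Q x (U x)) (at x within {a..b})" by simp
  then show ?thesis
    by (rule has_vector_derivative_transform[OF assms(1), rotated]) (use balance in auto)
qed

lemma mass_has_derivative:
  assumes "x \<in> {a..b}" "continuous (at x within {a..b}) U"
  shows "(mass_flux has_real_derivative rho (U x) * rvel x (U x)) (at x within {a..b})"
proof -
  have "((\<lambda>t. ray_flux Q t (U t) $ 1) has_vector_derivative radial_flux Q x (U x) $ 1) (at x within {a..b})"
    by (rule bounded_linear.has_vector_derivative[OF bounded_linear_vec_nth ray_flux_has_derivative[OF assms]])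
  then show ?thesis
    by (simp add: ray_flux_mass radial_flux_mass mass_flux_def[symmetric, abs_def]
        has_real_derivative_iff_has_vector_derivative)
qed

lemma ray_flux_has_derivative_at:
  assumes "isCont U x"
  shows "((\<lambda>t. ray_flux Q t (U t)) has_vector_derivative radial_flux Q x (U x)) (at x)"
    and "(mass_flux has_real_derivative rho (U x) * rvel x (U x)) (at x)"
proof -
  have x: "x \<in> {x - 1..x + 1}" "continuous (at x within {x - 1..x + 1}) U"
    "at x within {x - 1..x + 1} = at x"
    using assms by (auto intro: continuous_at_imp_continuous_at_within at_within_Icc_at)
  show "((\<lambda>t. ray_flux Q t (U t)) has_vector_derivative radial_flux Q x (U x)) (at x)"
    using ray_flux_has_derivative[OF x(1,2)] unfolding x(3) .
  show "(mass_flux has_real_derivative rho (U x) * rvel x (U x)) (at x)"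
    using mass_has_derivative[OF x(1,2)] unfolding x(3) .
qed

text \<open>The radial momentum balance \<open>(M L)' = \<rho> (L\<^sup>2 - N\<^sup>2)\<close>, divided
  by \<open>M\<close>, together with \<open>M' = \<rho> L\<close>. The quotient is differentiable because
  \<open>M L\<close> and \<open>M\<close> are, whereas \<open>N\<close> is only known to be
  continuous.\<close>

lemma rvel_has_derivative:
  assumes cont: "isCont U x" and nz: "mass_flux x \<noteq> 0"
  shows "((\<lambda>t. rvel t (U t)) has_real_derivative - nvel x (U x)) (at x)"
proof -
  define r N L p where "r = rho (U x)" and "N = nvel x (U x)" and "L = rvel x (U x)"
    and "p = pressure Q (U x)"
  define F where "F t = ray_flux Q t (U t)" for t
  define G where "G = radial_flux Q x (U x)"
  have comp: "((\<lambda>t. F t $ i) has_real_derivative G $ i) (at x)" for i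
    unfolding F_def G_def has_real_derivative_iff_has_vector_derivative
    by (rule bounded_linear.has_vector_derivative[OF bounded_linear_vec_nth
          ray_flux_has_derivative_at(1)[OF cont]])
  have "((\<lambda>t. F t $ 2 * cos t + F t $ 3 * sin t) has_real_derivative
      (G $ 2 * cos x + G $ 3 * sin x) - (F x $ 2 * sin x - F x $ 3 * cos x)) (at x)"
    by (auto intro!: derivative_eq_intros comp simp: algebra_simps)
  then have radial_momentum: "((\<lambda>t. mass_flux t * rvel t (U t)) has_real_derivative r * L\<^sup>2 - r * N\<^sup>2) (at x)"
    unfolding F_def G_def ray_flux_radial_momentum ray_flux_normal_momentum radial_flux_momentum
    by (simp add: mass_flux_def r_def N_def L_def)
  have "((\<lambda>t. mass_flux t * rvel t (U t) / mass_flux t) has_real_derivative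
      ((r * L\<^sup>2 - r * N\<^sup>2) * mass_flux x - mass_flux x * L * (r * L)) / (mass_flux x * mass_flux x)) (at x)"
    using DERIV_divide[OF radial_momentum ray_flux_has_derivative_at(2)[OF cont] nz]
    by (simp add: L_def r_def)
  moreover have "((r * L\<^sup>2 - r * N\<^sup>2) * mass_flux x - mass_flux x * L * (r * L)) / (mass_flux x * mass_flux x) = - N"
    using nz by (simp add: mass_flux_def r_def N_def field_simps power2_eq_square)
  ultimately have der: "((\<lambda>t. mass_flux t * rvel t (U t) / mass_flux t) has_real_derivative - N) (at x)"
    by simp
  have ev: "\<forall>\<^sub>F t in nhds x. mass_flux t * rvel t (U t) / mass_flux t = rvel t (U t)"
  proof -
    have "(mass_flux \<longlongrightarrow> mass_flux x) (nhds x)"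
      using isCont_mass by (simp add: isCont_def tendsto_at_iff_tendsto_nhds)
    then have "\<forall>\<^sub>F t in nhds x. mass_flux t \<noteq> 0" using nz by (rule tendsto_imp_eventually_ne)
    then show ?thesis by eventually_elim simp
  qed
  show ?thesis
    unfolding N_def[symmetric] by (rule iffD1[OF DERIV_cong_ev[OF refl ev refl] der])
qed

section \<open>Zeros and shocks of a solution\<close>

lemma rvel_nonzero:
  assumes "mass_flux \<theta> = 0"
  shows "rvel \<theta> (U \<theta>) \<noteq> 0"
proof
  assume "rvel \<theta> (U \<theta>) = 0"
  moreover have "nvel \<theta> (U \<theta>) = 0"
    using assms rho_pos[OF in_phase[of \<theta>]] by (simp add: mass_flux_def)
  ultimately have "xvel (U \<theta>) = 0" "yvel (U \<theta>) = 0"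
    by (simp_all add: xvel_yvel_polar[of _ \<theta>])
  then show False using nostag by (auto simp: no_stagnation_points_def norm_Pair)
qed

text \<open>At such a zero \<open>M\<close> has the right derivative \<open>\<rho> L\<close>, and
  \<open>L \<noteq> 0\<close> in the absence of stagnation. This can fail from the left, where the limit
  of the velocity may vanish.\<close>

lemma mass_zero_isolated_right:
  assumes "mass_flux a = 0"
  obtains \<epsilon> where "\<epsilon> > 0" "\<And>t. \<lbrakk>a < t; t < a + \<epsilon>\<rbrakk> \<Longrightarrow> mass_flux t \<noteq> 0"
proof -
  have "at a within {a..a + 1} = at_right a" by (rule at_within_Icc_at_right) simp
  then have "continuous (at a within {a..a + 1}) U"
    using rcont by (simp add: continuous_within right_continuous_version_def)
  then have der: "(mass_flux has_real_derivative rho (U a) * rvel a (U a)) (at a within {a..a + 1})"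
    by (intro mass_has_derivative) auto
  have "rho (U a) * rvel a (U a) \<noteq> 0"
    using rho_pos[OF in_phase[of a]] rvel_nonzero[OF assms] by simp
  then consider "rho (U a) * rvel a (U a) > 0" | "rho (U a) * rvel a (U a) < 0" by linarith
  then obtain d where "d > 0" and d: "\<And>h. \<lbrakk>0 < h; a + h \<in> {a..a + 1}; h < d\<rbrakk> \<Longrightarrow> mass_flux (a + h) \<noteq> 0"
  proof cases
    case 1
    from has_real_derivative_pos_inc_right[OF der 1] that assms show ?thesis by force
  next
    case 2
    from has_real_derivative_neg_dec_right[OF der 2] that assms show ?thesis by force
  qed
  show ?thesis
  proof (rule that[of "min d 1"])
    show "mass_flux t \<noteq> 0" if "a < t" "t < a + min d 1" for t
      using d[of "t - a"] that by auto
  qed (use \<open>d > 0\<close> in simp)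
qed

text \<open>It suffices to consider the first zero \<open>c\<close> after \<open>a\<close>. Between
  \<open>a\<close> and \<open>c\<close> every discontinuity is a shock, and shocks are too far from
  \<open>a\<close> to occur if \<open>c - a < \<delta>\<close>.\<close>

lemma zeros_separated:
  assumes shocks: "\<And>\<theta>\<^sub>0 \<theta>. \<lbrakk>mass_flux \<theta>\<^sub>0 = 0; shock U \<theta>\<rbrakk> \<Longrightarrow> \<delta> \<le> \<bar>\<theta> - \<theta>\<^sub>0\<bar>"
    and ab: "a < b" "mass_flux a = 0" "mass_flux b = 0"
  shows "min \<delta> (1 / K) \<le> b - a"
proof -
  obtain \<epsilon> where \<epsilon>: "\<epsilon> > 0" "\<And>t. \<lbrakk>a < t; t < a + \<epsilon>\<rbrakk> \<Longrightarrow> mass_flux t \<noteq> 0"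
    using mass_zero_isolated_right[OF ab(2)] by blast
  define Z where "Z = {a + \<epsilon>..b} \<inter> mass_flux -` {0}"
  have cont: "continuous_on A mass_flux" for A
    using isCont_mass by (simp add: continuous_at_imp_continuous_on)
  have "closed Z" unfolding Z_def by (intro continuous_closed_preimage cont) auto
  moreover have "bounded Z" unfolding Z_def by (rule bounded_subset[OF bounded_closed_interval]) auto
  moreover have "b \<in> Z" using \<epsilon>(2)[of b] ab by (force simp: Z_def)
  ultimately obtain c where c: "c \<in> Z" and least: "\<And>t. t \<in> Z \<Longrightarrow> c \<le> t"
    using compact_attains_inf[of Z] by (auto simp: compact_eq_bounded_closed)
  have "a < c" "c \<le> b" "mass_flux c = 0" using c \<epsilon>(1) by (auto simp: Z_def)
  have nz: "mass_flux t \<noteq> 0" if "a < t" "t < c" for t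
    using \<epsilon>(2)[of t] least[of t] that \<open>c \<le> b\<close> by (force simp: Z_def)
  have "min \<delta> (1 / K) \<le> c - a"
  proof (cases "c - a < \<delta>")
    case True
    have U: "isCont U t" if "a < t" "t < c" for t
      using discontinuity_is_shock[of t] nz[OF that] shocks[OF ab(2), of t] that True by force
    have "1 / K \<le> c - a"
    proof (rule zero_gap[where r = "\<lambda>t. rho (U t)" and N = "\<lambda>t. nvel t (U t)"])
      show "continuous_on {a..<c} (\<lambda>t. rvel t (U t))"
        unfolding continuous_on_eq_continuous_within
      proof
        fix t assume t: "t \<in> {a..<c}"
        show "continuous (at t within {a..<c}) (\<lambda>t. rvel t (U t))"
        proof (cases "t = a")
          case True
          have "(U \<longlongrightarrow> U a) (at_right a)" using rcont by (simp add: right_continuous_version_def)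
          then have "((\<lambda>t. f (U t)) \<longlongrightarrow> f (U a)) (at_right a)" if "continuous_on (phase_space K) f"
            for f :: "real^4 \<Rightarrow> real"
            by (rule continuous_on_tendsto_compose[OF that]) (simp_all add: in_phase)
          from this[OF continuous_on_state_variables(2)[OF rho_pos]]
            this[OF continuous_on_state_variables(3)[OF rho_pos]]
          have "((\<lambda>t. rvel t (U t)) \<longlongrightarrow> rvel a (U a)) (at_right a)"
            unfolding rvel_def by (intro tendsto_intros)
          moreover have "at a within {a..<c} = at_right a"
            using \<open>a < c\<close> by (intro at_within_nhd[of _ "{..<c}"]) auto
          ultimately show ?thesis using True by (simp add: continuous_within)
        next
          case False
          then have "isCont (\<lambda>t. rvel t (U t)) t"
            using t U[of t] nz[of t] by (intro DERIV_isCont[OF rvel_has_derivative]) auto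
          then show ?thesis by (rule continuous_at_imp_continuous_at_within)
        qed
      qed
      fix t assume t: "a < t" "t < c"
      show "(mass_flux has_real_derivative rho (U t) * rvel t (U t)) (at t)"
        using ray_flux_has_derivative_at(2) U t by blast
      show "((\<lambda>t. rvel t (U t)) has_real_derivative - nvel t (U t)) (at t)"
        using rvel_has_derivative U nz t by blast
      show "0 < rho (U t) \<and> rho (U t) \<le> K"
        using rho_pos in_phase[of t] by (simp add: phase_space_def)
      have "1 \<le> K * rho (U t)"
        using in_phase[of t] K by (simp add: phase_space_def field_simps)
      then have "1 * \<bar>nvel t (U t)\<bar> \<le> K * rho (U t) * \<bar>nvel t (U t)\<bar>"
        by (rule mult_right_mono) simp
      then show "\<bar>nvel t (U t)\<bar> \<le> K * \<bar>mass_flux t\<bar>"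
        using rho_pos[OF in_phase[of t]] by (simp add: mass_flux_def abs_mult)
    qed (use \<open>a < c\<close> K ab rvel_nonzero cont \<open>mass_flux c = 0\<close> in auto)
    then show ?thesis by simp
  qed simp
  then show ?thesis using \<open>c \<le> b\<close> by simp
qed

end

theorem lemma4:
  fixes Q :: eos and K :: real
  assumes "equation_of_state Q"
    and "K > 1"
    and "eos_defined_on Q (phase_space K)"
  shows "\<exists>\<delta>>0. \<forall>U.
    steady_selfsimilar_entropy_solution Q K U \<and> no_stagnation_points U \<and>
    right_continuous_version U \<longrightarrow>
      finite {\<theta> \<in> {0..<2 * pi}. normal_velocity U \<theta> = 0} \<and>
      (\<forall>\<theta>\<^sub>0 \<theta>'. normal_velocity U \<theta>\<^sub>0 = 0 \<and> shock U \<theta>' \<longrightarrow> \<bar>\<theta>' - \<theta>\<^sub>0\<bar> \<ge> \<delta>)"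
proof -
  interpret gas Q K using assms by unfold_locales
  obtain m where m: "m > 0" "\<And>\<theta> V W. \<lbrakk>V \<in> phase_space K; W \<in> phase_space K; V \<noteq> W;
      nvel \<theta> V \<noteq> 0; ray_flux Q \<theta> V = ray_flux Q \<theta> W\<rbrakk> \<Longrightarrow> m \<le> \<bar>rho V * nvel \<theta> V\<bar>"
    using mass_flux_across_discontinuity by auto
  obtain B where B: "B > 0" "\<And>\<theta> V. V \<in> phase_space K \<Longrightarrow> norm (radial_flux Q \<theta> V) \<le> B"
    using radial_flux_bound by auto
  \<comment> \<open>The angle within which \<open>M\<close> can grow from \<open>0\<close> to \<open>m\<close> at rate \<open>B\<close>.\<close>
  define \<delta> where "\<delta> = m / B"
  have "\<delta> > 0" using m(1) B(1) by (simp add: \<delta>_def)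
  have "finite {\<theta> \<in> {0..<2 * pi}. normal_velocity U \<theta> = 0} \<and>
      (\<forall>\<theta>\<^sub>0 \<theta>'. normal_velocity U \<theta>\<^sub>0 = 0 \<and> shock U \<theta>' \<longrightarrow> \<bar>\<theta>' - \<theta>\<^sub>0\<bar> \<ge> \<delta>)"
    if "steady_selfsimilar_entropy_solution Q K U" "no_stagnation_points U" "right_continuous_version U"
    for U
  proof -
    interpret flow Q K U using that by unfold_locales
    have far: "\<delta> \<le> \<bar>\<theta> - \<theta>\<^sub>0\<bar>" if zero: "mass_flux \<theta>\<^sub>0 = 0" and sh: "shock U \<theta>" for \<theta>\<^sub>0 \<theta>
    proof -
      obtain V where V: "V \<in> phase_space K" "V \<noteq> U \<theta>" "ray_flux Q \<theta> (U \<theta>) = ray_flux Q \<theta> V"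
        using rankine_hugoniot shock_mass_nonzero(1)[OF sh] by blast
      have "m \<le> \<bar>mass_flux \<theta>\<bar>"
        unfolding mass_flux_def
        using m(2)[OF in_phase V(1) V(2)[symmetric] shock_mass_nonzero(2)[OF sh] V(3)] .
      also have "\<dots> \<le> B * \<bar>\<theta> - \<theta>\<^sub>0\<bar>"
        using mass_lipschitz[OF B(2), of \<theta> \<theta>\<^sub>0] zero by simp
      finally show ?thesis using B(1) by (simp add: \<delta>_def field_simps)
    qed
    have "finite {\<theta> \<in> {0..<2 * pi}. mass_flux \<theta> = 0}"
    proof (rule finite_separated)
      show "min \<delta> (1 / K) > 0" using \<open>\<delta> > 0\<close> K by simp
      show "bounded {\<theta> \<in> {0..<2 * pi}. mass_flux \<theta> = 0}"
        by (rule bounded_subset[OF bounded_closed_interval[of 0 "2 * pi"]]) auto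
    qed (use zeros_separated[OF far] in auto)
    with far show ?thesis by (simp add: normal_velocity_zero_iff)
  qed
  with \<open>\<delta> > 0\<close> show ?thesis by blast
qed

end
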